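(* Let $D_c>0$ and let $\tau>0$ be such that $D_{d,\tau}>0$. Then $$\mathcal{L}^*_{\mathrm{CT}}(D_c,\tau)\ \ge\ \mathcal{L}^*_{\mathrm{DT}}(D_{d,\tau},\bar Q_{A,\tau},\tau)\ \ge\ \frac1\tau\,\theta^{-1}\big(R(D_{d,\tau},\bar Q_{A,\tau},\tau)\big).$$
   Context: Standing assumptions: $A\in\mathbb{R}^{n\times n}$ is Hurwitz, $BB^\top\succ0$, and $\Sigma_0\succ0$. Source: $dx_t=Ax_t\,dt+B\,dw_t$ for $t\ge0$, with $x_0\sim\mathcal{N}(0,\Sigma_0)$ and $w$ a standard $n$-dimensional Brownian motion independent of $x_0$. For $\tau>0$ let $x(k)=x_{k\tau}$, so that $x(k+1)=A_\tau x(k)+B_\tau w(k)$, with $w(k)$ i.i.d. $\mathcal{N}(0,I_n)$ and $w(k)$ independent of $(w(0:k-1),x(0:k))$. Here - $A_s=e^{As}$; - $B_s=\big(\int_0^s e^{A\lambda}BB^\top e^{A^\top\lambda}d\lambda\big)^{1/2}$. Encoding policies: $\{0,1\}^*$ is the set of finite binary strings, including $\emptyset$; $\ell(a)$ is the length of $a$, with $\ell(\emptyset)=0$. A causal encoding policy $\mathbb{P}_E$ is a sequence of Borel kernels $\mathbb{P}[a(k)\mid a(0:k-1),x(0:k)]$ with $a(k)\in\{0,1\}^*$. Definition of $\mathcal{L}^*_{\mathrm{CT}}$: $$\mathcal{L}^*_{\mathrm{CT}}(D_c,\tau)=\inf_{\mathbb{P}_E}\limsup_{K\to\infty}\frac1{K\tau}\sum_{k<K}\mathbb{E}[\ell(a(k))]$$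 subject to $$\limsup_{T\to\infty}\frac1T\int_0^T\mathbb{E}\|x_t-\hat x_t\|_2^2dt\le D_c,$$ with $\hat x_t=\mathbb{E}[x_t\mid a(0:\lfloor t/\tau\rfloor)]$. Definition of $\mathcal{L}^*_{\mathrm{DT}}$: for $D>0$ and $Q\succeq0$, $$\mathcal{L}^*_{\mathrm{DT}}(D,Q,\tau)=\inf_{\mathbb{P}_E}\limsup_{K\to\infty}\frac1{K\tau}\sum_{k<K}\mathbb{E}[\ell(a(k))]$$ subject to $$\limsup_{K\to\infty}\frac1K\sum_{k<K}\mathbb{E}\|x(k)-\hat x(k)\|_Q^2\le D,$$ with $\hat x(k)=\mathbb{E}[x(k)\mid a(0:k)]$ and $\|v\|_Q^2=v^\top Qv$. In both definitions $\inf\emptyset=+\infty$. Definition of the DT causal rate-distortion function: a causal reconstruction policy $\mathbb{P}_R$ is a sequence of Borel kernels $\mathbb{P}[\hat x(k)\mid\hat x(0:k-1),x(0:k)]$, $k\in\mathbb{N}_0$. For $D>0$ and $Q\succ0$, $$R(D,Q,\tau)=\inf_{\mathbb{P}_R}\limsup_{K\to\infty}\frac1K I\big(x(0:K-1);\hat x(0:K-1)\big)$$ subject to $$\limsup_{K\to\infty}\frac1K\sum_{k<K}\mathbb{E}\|x(k)-\hat x(k)\|_Q^2\le D,$$ with mutual information in bits, computed for the sampled process above. Discretization quantities: - $\bar Q_{A,\tau}=\int_0^\tau e^{A^\top t}e^{At}dt$; - $\bar b_\tau=\mathrm{Tr}\int_0^\tau B_sB_s^\top ds$; - $D_{d,\tau}=D_c\tau-\bar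 b_\tau$. The function $\theta$: $\theta(x)=x+(1+x)\log_2(1+x)-x\log_2x$ on $[0,\infty)$, with $0\log0=0$. It is strictly increasing and concave, with inverse $\theta^{-1}$ and $\theta^{-1}(+\infty)=+\infty$. *)

theory Defs
  imports "HOL-Probability.Probability"
begin

fun mat_pow :: "real^'n^'n \<Rightarrow> nat \<Rightarrow> real^'n^'n" where
  "mat_pow M 0 = mat 1"
| "mat_pow M (Suc k) = M ** mat_pow M k"

definition mexp :: "real^'n^'n \<Rightarrow> real^'n^'n" where
  "mexp M = (\<Sum>k. (1 / (fact k :: real)) *\<^sub>R mat_pow M k)"

definition hurwitz :: "real^'n^'n \<Rightarrow> bool" where
  "hurwitz A \<longleftrightarrow> (\<forall>z::complex. det ((\<chi> i j. (if i = j then z else 0) - complex_of_real (A $ i $ j)) :: complex^'n^'n) = 0 \<longrightarrow> Re z < 0)"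

definition pos_def :: "real^'n^'n \<Rightarrow> bool" where
  "pos_def S \<longleftrightarrow> transpose S = S \<and> (\<forall>v. v \<noteq> 0 \<longrightarrow> v \<bullet> (S *v v) > 0)"

definition qnorm2 :: "real^'n^'n \<Rightarrow> real^'n \<Rightarrow> real" where
  "qnorm2 Q v = v \<bullet> (Q *v v)"

definition A_s :: "real^'n^'n \<Rightarrow> real \<Rightarrow> real^'n^'n" where
  "A_s A s = mexp (s *\<^sub>R A)"

text \<open>B_s B_s^T = \<integral>_0^s e^{A\<lambda>} B B^T e^{A^T \<lambda>} d\<lambda> (B_s is its positive semidefinite square root).\<close>
definition BBt_s :: "real^'n^'n \<Rightarrow> real^'n^'n \<Rightarrow> real \<Rightarrow> real^'n^'n" where
  "BBt_s A B s = integral {0..s} (\<lambda>l. A_s A l ** (B ** transpose B) ** transpose (A_s A l))"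

definition Qbar :: "real^'n^'n \<Rightarrow> real \<Rightarrow> real^'n^'n" where
  "Qbar A \<tau> = integral {0..\<tau>} (\<lambda>t. mexp (t *\<^sub>R transpose A) ** mexp (t *\<^sub>R A))"

definition bbar :: "real^'n^'n \<Rightarrow> real^'n^'n \<Rightarrow> real \<Rightarrow> real" where
  "bbar A B \<tau> = trace (integral {0..\<tau>} (\<lambda>s. BBt_s A B s))"

definition Dd :: "real^'n^'n \<Rightarrow> real^'n^'n \<Rightarrow> real \<Rightarrow> real \<Rightarrow> real" where
  "Dd A B Dc \<tau> = Dc * \<tau> - bbar A B \<tau>"

definition theta :: "real \<Rightarrow> real" where
  "theta x = x + (1 + x) * log 2 (1 + x) - (if x = 0 then 0 else x * log 2 x)"

definition theta_inv :: "real \<Rightarrow> real" where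
  "theta_inv y = (THE x. 0 \<le> x \<and> theta x = y)"

definition theta_inv_e :: "ereal \<Rightarrow> ereal" where
  "theta_inv_e r = (case r of ereal y \<Rightarrow> ereal (theta_inv y) | PInfty \<Rightarrow> \<infinity> | MInfty \<Rightarrow> 0)"

definition gauss_pdf :: "real^'n^'n \<Rightarrow> real^'n \<Rightarrow> real" where
  "gauss_pdf S v = exp (- (v \<bullet> (matrix_inv S *v v)) / 2) / sqrt ((2 * pi) ^ CARD('n) * det S)"

definition gauss :: "real^'n^'n \<Rightarrow> (real^'n) measure" where
  "gauss S = density lborel (\<lambda>v. ennreal (gauss_pdf S v))"

definition gen_sets :: "'a measure \<Rightarrow> 'b measure \<Rightarrow> ('a \<Rightarrow> 'b) \<Rightarrow> 'a set set" where
  "gen_sets M N f = {f -` S \<inter> space M | S. S \<in> sets N}"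

definition sig :: "'a measure \<Rightarrow> 'a set set \<Rightarrow> 'a measure" where
  "sig M G = sigma (space M) G"

definition vcond_exp :: "'a measure \<Rightarrow> 'a measure \<Rightarrow> ('a \<Rightarrow> real^'n) \<Rightarrow> 'a \<Rightarrow> real^'n" where
  "vcond_exp M F X = (\<lambda>\<omega>. \<chi> i. real_cond_exp M F (\<lambda>\<omega>'. X \<omega>' $ i) \<omega>)"

abbreviation cw :: "bool list measure" where
  "cw \<equiv> count_space UNIV"

text \<open>Mutual information (in bits) between sigma-algebras G and H, general
 (Gelfand-Yaglom-Dobrushin) definition: supremum over finite measurable partitions.\<close>
definition fin_part :: "'a measure \<Rightarrow> 'a set set \<Rightarrow> 'a set set \<Rightarrow> bool" where
  "fin_part M G P \<longleftrightarrow> finite P \<and> P \<subseteq> G \<and> \<Union>P = space M \<and> disjoint P"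

definition mutual_info :: "'a measure \<Rightarrow> 'a set set \<Rightarrow> 'a set set \<Rightarrow> ereal" where
  "mutual_info M G H = (SUP PQ \<in> {(P, Q). fin_part M G P \<and> fin_part M H Q}.
     ereal (\<Sum>E\<in>fst PQ. \<Sum>F\<in>snd PQ.
        (let p = measure M (E \<inter> F) in
         if p = 0 then 0 else p * log 2 (p / (measure M E * measure M F)))))"

text \<open>Continuous-time source dx = Ax dt + B dw, x_0 ~ N(0,S0), characterised through its
 (Markov) transition structure: for 0 \<le> s < t, x_t - e^{A(t-s)} x_s is N(0, B_{t-s}B_{t-s}^T)
 and independent of the past sigma(x_r : 0 \<le> r \<le> s).\<close>
definition ct_source :: "real measure \<Rightarrow> real^'n^'n \<Rightarrow> real^'n^'n \<Rightarrow> real^'n^'n \<Rightarrow> (real \<Rightarrow> real \<Rightarrow> real^'n) \<Rightarrow> bool" where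
  "ct_source M A B S0 x \<longleftrightarrow> prob_space M \<and>
     (\<forall>t\<ge>0. x t \<in> borel_measurable M) \<and>
     distr M borel (x 0) = gauss S0 \<and>
     (\<forall>s t. 0 \<le> s \<and> s < t \<longrightarrow>
        distr M borel (\<lambda>\<omega>. x t \<omega> - A_s A (t - s) *v x s \<omega>) = gauss (BBt_s A B (t - s)) \<and>
        prob_space.indep_set M
          (sets (sig M (gen_sets M borel (\<lambda>\<omega>. x t \<omega> - A_s A (t - s) *v x s \<omega>))))
          (sets (sig M (\<Union>r\<in>{0..s}. gen_sets M borel (x r)))))"

text \<open>Sampled source x(k) = x_{k\<tau>}: x(k+1) = A_\<tau> x(k) + B_\<tau> w(k), w(k) ~ N(0,I) independent of x(0:k).\<close>
definition dt_source :: "real measure \<Rightarrow> real^'n^'n \<Rightarrow> real^'n^'n \<Rightarrow> real^'n^'n \<Rightarrow> real \<Rightarrow> (nat \<Rightarrow> real \<Rightarrow> real^'n) \<Rightarrow> bool" where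
  "dt_source M A B S0 \<tau> x \<longleftrightarrow> prob_space M \<and>
     (\<forall>k. x k \<in> borel_measurable M) \<and>
     distr M borel (x 0) = gauss S0 \<and>
     (\<forall>k. distr M borel (\<lambda>\<omega>. x (Suc k) \<omega> - A_s A \<tau> *v x k \<omega>) = gauss (BBt_s A B \<tau>) \<and>
        prob_space.indep_set M
          (sets (sig M (gen_sets M borel (\<lambda>\<omega>. x (Suc k) \<omega> - A_s A \<tau> *v x k \<omega>))))
          (sets (sig M (\<Union>j\<le>k. gen_sets M borel (x j)))))"

text \<open>Causal kernel condition: the conditional law of y(k) given the whole source and
 y(0:k-1) coincides with the one given x(0:k) and y(0:k-1), i.e. y(k) is drawn from a
 Borel kernel P[y(k) | y(0:k-1), x(0:k)].  All_x generates sigma(whole source), past_x k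
 generates sigma(x(0:k)).\<close>
definition causal_kernel :: "'a measure \<Rightarrow> 'b measure \<Rightarrow> 'a set set \<Rightarrow> (nat \<Rightarrow> 'a set set) \<Rightarrow> (nat \<Rightarrow> 'a \<Rightarrow> 'b) \<Rightarrow> bool" where
  "causal_kernel M N All_x past_x y \<longleftrightarrow>
     (\<forall>k. y k \<in> measurable M N) \<and>
     (\<forall>k. \<forall>S\<in>sets N.
        AE \<omega> in M.
          real_cond_exp M (sig M (All_x \<union> (\<Union>j<k. gen_sets M N (y j))))
             (indicator (y k -` S \<inter> space M)) \<omega>
        = real_cond_exp M (sig M (past_x k \<union> (\<Union>j<k. gen_sets M N (y j))))
             (indicator (y k -` S \<inter> space M)) \<omega>)"

definition ct_rate :: "real measure \<Rightarrow> real \<Rightarrow> (nat \<Rightarrow> real \<Rightarrow> bool list) \<Rightarrow> ennreal" where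
  "ct_rate M \<tau> a = limsup (\<lambda>K. ennreal (1 / (real K * \<tau>)) *
       (\<Sum>k<K. \<integral>\<^sup>+ \<omega>. ennreal (real (length (a k \<omega>))) \<partial>M))"

text \<open>Continuous-time operational rate L*_CT(Dc, \<tau>); realisations live on a probability space
 with sample space of type real (rich enough for any standard Borel model).\<close>
definition L_CT :: "real^'n^'n \<Rightarrow> real^'n^'n \<Rightarrow> real^'n^'n \<Rightarrow> real \<Rightarrow> real \<Rightarrow> ereal" where
  "L_CT A B S0 Dc \<tau> = (INF (M, x, a) \<in>
     {(M, x, a). ct_source M A B S0 x \<and>
        causal_kernel M cw (\<Union>t\<in>{0..}. gen_sets M borel (x t))
          (\<lambda>k. \<Union>j\<le>k. gen_sets M borel (x (real j * \<tau>))) a \<and>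
        Limsup at_top (\<lambda>T. ennreal (1 / T) *
          (\<integral>\<^sup>+ t\<in>{0..T}. (\<integral>\<^sup>+ \<omega>. ennreal ((norm (x t \<omega> -
              vcond_exp M (sig M (\<Union>j\<le>nat \<lfloor>t / \<tau>\<rfloor>. gen_sets M cw (a j))) (x t) \<omega>))\<^sup>2) \<partial>M) \<partial>lborel))
        \<le> ennreal Dc}.
     enn2ereal (ct_rate M \<tau> a))"

definition L_DT :: "real^'n^'n \<Rightarrow> real^'n^'n \<Rightarrow> real^'n^'n \<Rightarrow> real \<Rightarrow> real^'n^'n \<Rightarrow> real \<Rightarrow> ereal" where
  "L_DT A B S0 D Q \<tau> = (INF (M, x, a) \<in>
     {(M, x, a). dt_source M A B S0 \<tau> x \<and>
        causal_kernel M cw (\<Union>j. gen_sets M borel (x j))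
          (\<lambda>k. \<Union>j\<le>k. gen_sets M borel (x j)) a \<and>
        limsup (\<lambda>K. ennreal (1 / real K) *
          (\<Sum>k<K. \<integral>\<^sup>+ \<omega>. ennreal (qnorm2 Q (x k \<omega> -
              vcond_exp M (sig M (\<Union>j\<le>k. gen_sets M cw (a j))) (x k) \<omega>)) \<partial>M))
        \<le> ennreal D}.
     enn2ereal (ct_rate M \<tau> a))"

definition R_DT :: "real^'n^'n \<Rightarrow> real^'n^'n \<Rightarrow> real^'n^'n \<Rightarrow> real \<Rightarrow> real^'n^'n \<Rightarrow> real \<Rightarrow> ereal" where
  "R_DT A B S0 D Q \<tau> = (INF (M, x, xh) \<in>
     {(M, x, xh). dt_source M A B S0 \<tau> x \<and>
        causal_kernel M (borel :: (real^'n) measure) (\<Union>j. gen_sets M borel (x j))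
          (\<lambda>k. \<Union>j\<le>k. gen_sets M borel (x j)) xh \<and>
        limsup (\<lambda>K. ennreal (1 / real K) *
          (\<Sum>k<K. \<integral>\<^sup>+ \<omega>. ennreal (qnorm2 Q (x k \<omega> - xh k \<omega>)) \<partial>M))
        \<le> ennreal D}.
     limsup (\<lambda>K. ereal (1 / real K) *
        mutual_info M (sets (sig M (\<Union>j<K. gen_sets M borel (x j))))
                      (sets (sig M (\<Union>j<K. gen_sets M borel (xh j))))))"

end

theory Submission
  imports Defs
begin

text \<open>First inequality: sampling a continuous-time policy at the instants \<open>k\<tau>\<close> gives a discrete-time
  policy of the same rate. Since codewords depend on the source only through the samples, the noise
  accumulated after \<open>k\<tau>\<close> is independent of the samples and codewords up to time \<open>k\<close>; hence at
  time \<open>k\<tau> + s\<close> the estimation error is \<open>A_s A s\<close> applied to the error at \<open>k\<tau>\<close>, plus independent noise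
  with covariance \<open>BBt_s A B s\<close>. Integrating over a period yields the \<open>Qbar\<close>-weighted sampled error plus
  \<open>bbar\<close>.

  Second inequality: the conditional means are themselves a causal reconstruction, and by data processing their mutual
  information with the source is at most the entropy of the codewords. Gibbs' inequality bounds the
  latter by the cross entropy against independent words of geometric length with mean \<open>L\<close>, which is at most
  \<open>K * theta L\<close> as soon as the average codeword length is at most \<open>L\<close>.\<close>

section \<open>Conditional independence and causal kernels\<close>

text \<open>All three infima range over realisations (a measure, a source, an output sequence), so
  each inequality turns a feasible triple into another one on the same \<open>M\<close>, and no
  probability space has to be built. The delicate constraint is \<open>causal_kernel\<close>. It
  compares conditioning on the whole source with conditioning on the past, and it is not visibly
  preserved when the outputs are replaced by functions of them, because the history in the condition
  changes as well. It is therefore translated into conditional independence of source and outputs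
  given the past samples; this notion passes to functions of the outputs, and a kernel condition can
  be recovered from it.

  The shape of \<open>theta\<close> reflects that codewords need not be prefix-free: all
  \<open>2 ^ n\<close> words of length \<open>n\<close> are admissible, and the length itself
  carries information. Thus \<open>theta L\<close> is \<open>L\<close> bits of content plus the
  entropy of a geometric length of mean \<open>L\<close>.\<close>

lemma space_sig [simp]: "space (sig M X) = space M"
  by (simp add: sig_def space_measure_of_conv)

lemma sets_sig: "X \<subseteq> sets M \<Longrightarrow> sets (sig M X) = sigma_sets (space M) X"
  unfolding sig_def using sets.space_closed by (subst sets_measure_of) blast+

lemma sig_superset: "X \<subseteq> sets M \<Longrightarrow> X \<subseteq> sets (sig M X)"
  by (auto simp: sets_sig)

lemma subalgebra_sig: "X \<subseteq> sets M \<Longrightarrow> subalgebra M (sig M X)"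
  using sets.sigma_sets_subset by (auto simp: subalgebra_def sets_sig)

lemma subalgebra_sig_least:
  assumes "X \<subseteq> sets M" "X \<subseteq> sets F" "space F = space M"
  shows "subalgebra F (sig M X)"
  using assms sets.sigma_sets_subset[of X F] by (auto simp: subalgebra_def sets_sig)

lemma subalgebra_sig_mono: "X \<subseteq> Y \<Longrightarrow> Y \<subseteq> sets M \<Longrightarrow> subalgebra (sig M Y) (sig M X)"
  using sig_superset[of Y M] by (intro subalgebra_sig_least) auto

lemma sets_sig_mono: "X \<subseteq> Y \<Longrightarrow> Y \<subseteq> sets M \<Longrightarrow> sets (sig M X) \<subseteq> sets (sig M Y)"
  using subalgebra_sig_mono[of X Y M] by (simp add: subalgebra_def)

lemma gen_sets_subset: "f \<in> measurable M N \<Longrightarrow> gen_sets M N f \<subseteq> sets M"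
  by (auto simp: gen_sets_def)

lemma gen_sets_subset_subalgebra:
  "f \<in> measurable F N \<Longrightarrow> space F = space M \<Longrightarrow> gen_sets M N f \<subseteq> sets F"
  by (auto simp: gen_sets_def dest: measurable_sets)

lemma measurable_gen_sets:
  assumes "f \<in> measurable M N" "gen_sets M N f \<subseteq> sets F" "space F = space M"
  shows "f \<in> measurable F N"
  using assms by (auto simp: measurable_def gen_sets_def)

text \<open>Preimages of measurable sets already form a sigma-algebra, so generating adds no new
  sets.\<close>

lemma sets_sig_gen_sets:
  assumes "f \<in> measurable M N" "E \<in> sets (sig M (gen_sets M N f))"
  shows "\<exists>S\<in>sets N. E = f -` S \<inter> space M"
proof -
  have "sets (sig M (gen_sets M N f)) = sets (vimage_algebra (space M) f N)"
    unfolding sets_sig[OF gen_sets_subset[OF assms(1)]] by (simp add: gen_sets_def sets_vimage_algebra)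
  with assms show ?thesis
    using measurable_space[OF assms(1)] by (auto simp: sets_vimage_algebra2)
qed

section \<open>Conditional expectation on a probability space\<close>

context prob_space
begin

lemma subalgebra_sigma_finite: "subalgebra M F \<Longrightarrow> sigma_finite_subalgebra M F"
  by (intro finite_measure_subalgebra_is_sigma_finite)
     (simp add: finite_measure_subalgebra_def finite_measure_subalgebra_axioms_def finite_measure_axioms)

lemma integrable_indicator_real: "E \<in> sets M \<Longrightarrow> integrable M (indicator E :: 'a \<Rightarrow> real)"
  by (rule integrable_real_indicator) (auto simp: emeasure_finite less_top[symmetric])

lemma real_cond_exp_indicator_bounds:
  assumes "subalgebra M F" "E \<in> sets M"
  shows "AE w in M. \<bar>real_cond_exp M F (indicator E) w\<bar> \<le> 1"
proof -
  interpret sigma_finite_subalgebra M F by (rule subalgebra_sigma_finite[OF assms(1)])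
  have "AE w in M. real_cond_exp M F (indicator E) w \<ge> 0"
    by (rule real_cond_exp_ge_c[OF integrable_indicator_real[OF assms(2)]]) auto
  moreover have "AE w in M. real_cond_exp M F (indicator E) w \<le> 1"
    by (rule real_cond_exp_le_c[OF integrable_indicator_real[OF assms(2)]]) (auto simp: indicator_def)
  ultimately show ?thesis by eventually_elim auto
qed

lemma integrable_mult_AE_bounded:
  fixes f g :: "'a \<Rightarrow> real"
  assumes "integrable M f" "g \<in> borel_measurable M" "AE w in M. \<bar>g w\<bar> \<le> c"
  shows "integrable M (\<lambda>w. f w * g w)"
proof (rule Bochner_Integration.integrable_bound[of M "\<lambda>w. c * f w"])
  show "AE w in M. norm (f w * g w) \<le> norm (c * f w)"
    using assms(3)
  proof eventually_elim
    case (elim w)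
    have "\<bar>f w\<bar> * \<bar>g w\<bar> \<le> \<bar>f w\<bar> * \<bar>c\<bar>" using elim by (intro mult_left_mono) auto
    then show ?case by (simp add: abs_mult mult.commute)
  qed
qed (use assms in auto)

lemma integrable_mult_cond_exp_indicator:
  fixes f :: "'a \<Rightarrow> real"
  assumes "subalgebra M F" "E \<in> sets M" "integrable M f"
  shows "integrable M (\<lambda>w. f w * real_cond_exp M F (indicator E) w)"
  by (rule integrable_mult_AE_bounded[OF assms(3) _ real_cond_exp_indicator_bounds[OF assms(1,2)]]) auto

lemma integrable_mult_indicator_real:
  fixes f :: "'a \<Rightarrow> real"
  assumes "E \<in> sets M" "integrable M f"
  shows "integrable M (\<lambda>w. indicator E w * f w)" "integrable M (\<lambda>w. f w * indicator E w)"
  using integrable_mult_indicator[OF assms] by (simp_all add: mult.commute)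

text \<open>Conditional expectation is self-adjoint: both sides equal the integral of the product of
  the two conditional expectations.\<close>

lemma real_cond_exp_swap:
  fixes f :: "'a \<Rightarrow> real"
  assumes "subalgebra M F" "E \<in> sets M" "integrable M f"
  shows "(\<integral>w. f w * real_cond_exp M F (indicator E) w \<partial>M) = (\<integral>w. real_cond_exp M F f w * indicator E w \<partial>M)"
proof -
  interpret sigma_finite_subalgebra M F by (rule subalgebra_sigma_finite[OF assms(1)])
  have "(\<integral>w. f w * real_cond_exp M F (indicator E) w \<partial>M)
      = (\<integral>w. real_cond_exp M F (indicator E) w * real_cond_exp M F f w \<partial>M)"
    using integrable_mult_cond_exp_indicator[OF assms] assms(3)
    by (subst real_cond_exp_intg(2)) (auto simp: mult.commute)
  also have "\<dots> = (\<integral>w. real_cond_exp M F f w * real_cond_exp M F (indicator E) w \<partial>M)"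
    by (simp add: mult.commute)
  also have "\<dots> = (\<integral>w. real_cond_exp M F f w * indicator E w \<partial>M)"
    using assms by (intro real_cond_exp_intg(2) integrable_mult_indicator_real real_cond_exp_int) auto
  finally show ?thesis .
qed

text \<open>The characterisation is phrased through the defect \<open>f - g\<close>, since that is
  the form in which \<open>integral_indicator_join_eq_0\<close> delivers a vanishing
  integral.\<close>

lemma real_cond_exp_eqI:
  fixes f g :: "'a \<Rightarrow> real"
  assumes "subalgebra M F" "integrable M f" "integrable M g" "g \<in> borel_measurable F"
    and "\<And>E. E \<in> sets F \<Longrightarrow> (\<integral>w. indicator E w * (f w - g w) \<partial>M) = 0"
  shows "AE w in M. real_cond_exp M F f w = g w"
proof -
  interpret sigma_finite_subalgebra M F by (rule subalgebra_sigma_finite[OF assms(1)])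
  show ?thesis
  proof (rule real_cond_exp_charact)
    fix E assume E: "E \<in> sets F"
    then have EM: "E \<in> sets M" using assms(1) by (auto simp: subalgebra_def)
    have "(\<integral>w. indicator E w * f w \<partial>M) - (\<integral>w. indicator E w * g w \<partial>M) = 0"
      using assms(5)[OF E] integrable_mult_indicator_real[OF EM] assms(2,3)
      by (subst Bochner_Integration.integral_diff[symmetric]) (auto simp: algebra_simps)
    then show "(\<integral>w\<in>E. f w \<partial>M) = (\<integral>w\<in>E. g w \<partial>M)"
      by (simp add: set_lebesgue_integral_def)
  qed (use assms in auto)
qed

text \<open>A Dynkin argument: the sets \<open>C \<inter> D\<close> are stable under intersection
  and generate a sigma-algebra containing \<open>E\<close>, and the vanishing of the integral passes
  to complements and countable disjoint unions.\<close>

lemma integral_indicator_join_eq_0: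
  fixes f :: "'a \<Rightarrow> real"
  assumes "subalgebra M F" "subalgebra M G" "integrable M f"
    and zero: "\<And>C D. C \<in> sets F \<Longrightarrow> D \<in> sets G \<Longrightarrow> (\<integral>w. indicator C w * indicator D w * f w \<partial>M) = 0"
    and X: "X \<subseteq> sets F \<union> sets G" and E: "E \<in> sets (sig M X)"
  shows "(\<integral>w. indicator E w * f w \<partial>M) = 0"
proof -
  let ?P = "{C \<inter> D | C D. C \<in> sets F \<and> D \<in> sets G}"
  have sp: "space F = space M" "space G = space M" and FM: "sets F \<subseteq> sets M" and GM: "sets G \<subseteq> sets M"
    using assms(1,2) by (auto simp: subalgebra_def)
  have PM: "?P \<subseteq> sets M" using FM GM by auto
  have FP: "sets F \<subseteq> ?P"
  proof
    fix C assume "C \<in> sets F"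
    moreover from this have "C = C \<inter> space M" using sets.sets_into_space[of C F] sp by auto
    moreover have "space M \<in> sets G" using sp by (metis sets.top)
    ultimately show "C \<in> ?P" by blast
  qed
  have GP: "sets G \<subseteq> ?P"
  proof
    fix C assume "C \<in> sets G"
    moreover from this have "C = space M \<inter> C" using sets.sets_into_space[of C G] sp by auto
    moreover have "space M \<in> sets F" using sp by (metis sets.top)
    ultimately show "C \<in> ?P" by blast
  qed
  have XM: "X \<subseteq> sets M" using X FM GM by auto
  have EP: "E \<in> sigma_sets (space M) ?P"
    using E X FP GP sigma_sets_mono'[of X ?P "space M"] unfolding sets_sig[OF XM] by blast
  have int_stable: "Int_stable ?P"
  proof (rule Int_stableI)
    fix a b assume "a \<in> ?P" "b \<in> ?P"
    then obtain C D C' D' where "a = C \<inter> D" "b = C' \<inter> D'" "C \<in> sets F" "C' \<in> sets F" "D \<in> sets G" "D' \<in> sets G"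
      by auto
    then have "a \<inter> b = (C \<inter> C') \<inter> (D \<inter> D')" "C \<inter> C' \<in> sets F" "D \<inter> D' \<in> sets G" by auto
    then show "a \<inter> b \<in> ?P" by blast
  qed
  have inM: "A \<in> sets M" if "A \<in> sigma_sets (space M) ?P" for A
    using sets.sigma_sets_subset[OF PM] that by auto
  \<comment> \<open>Complements need the total integral, which is the case where \<open>C\<close>
    and \<open>D\<close> are both the whole space.\<close>
  have all: "(\<integral>w. f w \<partial>M) = 0"
  proof -
    have "(\<integral>w. indicator (space M) w * indicator (space M) w * f w \<partial>M) = 0"
      using zero[of "space M" "space M"] sp by (metis sets.top)
    moreover have "(\<integral>w. indicator (space M) w * indicator (space M) w * f w \<partial>M) = (\<integral>w. f w \<partial>M)"
      by (rule Bochner_Integration.integral_cong) auto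
    ultimately show ?thesis by simp
  qed
  have "?P \<subseteq> Pow (space M)" using PM sets.space_closed by auto
  from int_stable this EP show ?thesis
  proof (induction rule: sigma_sets_induct_disjoint)
    fix A assume "A \<in> ?P"
    then show "(\<integral>w. indicator A w * f w \<partial>M) = 0"
      using zero by (auto simp: indicator_inter_arith)
  next
    fix A assume A: "A \<in> sigma_sets (space M) ?P" "(\<integral>w. indicator A w * f w \<partial>M) = 0"
    have "(\<integral>w. indicator (space M - A) w * f w \<partial>M) = (\<integral>w. f w - indicator A w * f w \<partial>M)"
      by (rule Bochner_Integration.integral_cong) (auto simp: indicator_def)
    also have "\<dots> = 0"
      using A all assms(3) integrable_mult_indicator_real(1)[OF inM[OF A(1)]] by simp
    finally show "(\<integral>w. indicator (space M - A) w * f w \<partial>M) = 0" .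
  next
    fix A :: "nat \<Rightarrow> 'a set"
    assume A: "disjoint_family A" "range A \<subseteq> sigma_sets (space M) ?P"
      "\<And>i. (\<integral>w. indicator (A i) w * f w \<partial>M) = 0"
    have AM: "A i \<in> sets M" for i using A(2) inM by auto
    have "(LINT w:(\<Union>i. A i)|M. f w) = (\<Sum>i. LINT w:A i|M. f w)"
    proof (rule lebesgue_integral_countable_add)
      show "set_integrable M (\<Union> (range A)) f"
        using AM assms(3) unfolding set_integrable_def by (intro integrable_mult_indicator) auto
    qed (use AM A(1) in \<open>auto simp: disjoint_family_on_def\<close>)
    then show "(\<integral>w. indicator (\<Union>i. A i) w * f w \<partial>M) = 0"
      using A(3) by (simp add: set_lebesgue_integral_def)
  qed simp
qed

text \<open>Conditional independence of \<open>H\<close> and \<open>G\<close> given \<open>F\<close>, phrased so that it makes sense also when \<open>G\<close> contains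
  \<open>F\<close>: conditioning an event of \<open>H\<close> on \<open>G\<close> gives no more than conditioning it on \<open>F\<close>.\<close>

definition cond_indep :: "'a measure \<Rightarrow> 'a measure \<Rightarrow> 'a measure \<Rightarrow> bool" where
  "cond_indep F H G \<longleftrightarrow> (\<forall>B\<in>sets H. \<forall>E\<in>sets G.
     (\<integral>w. indicator E w * (indicator B w - real_cond_exp M F (indicator B) w) \<partial>M) = 0)"

text \<open>Passes from indicators to integrable functions by duality instead of approximation. With
  \<open>V\<close> the defect of an event \<open>E\<close> of \<open>G\<close>, self-adjointness
  moves the conditioning from \<open>B\<close> to \<open>E\<close>, so \<open>V\<close> has zero
  conditional expectation given \<open>H\<close> and is orthogonal to \<open>f\<close>.\<close>

lemma cond_indep_real_cond_exp:
  fixes f :: "'a \<Rightarrow> real"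
  assumes sub: "subalgebra M F" "subalgebra M H" "subalgebra M G" "subalgebra G F"
    and ci: "cond_indep F H G" and f: "integrable M f" "f \<in> borel_measurable H"
  shows "AE w in M. real_cond_exp M G f w = real_cond_exp M F f w"
proof -
  interpret F: sigma_finite_subalgebra M F by (rule subalgebra_sigma_finite) fact
  interpret H: sigma_finite_subalgebra M H by (rule subalgebra_sigma_finite) fact
  interpret G: sigma_finite_subalgebra M G by (rule subalgebra_sigma_finite) fact
  show ?thesis
  proof (rule real_cond_exp_eqI)
    show "real_cond_exp M F f \<in> borel_measurable G"
      by (rule measurable_from_subalg[OF sub(4)]) simp
    show "integrable M (real_cond_exp M F f)" using f by auto
    fix E assume E: "E \<in> sets G"
    then have EM: "E \<in> sets M" using sub by (auto simp: subalgebra_def)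
    note iE = integrable_indicator_real[OF EM]
    define V where "V w = indicator E w - real_cond_exp M F (indicator E) w" for w
    have V: "integrable M V" "V \<in> borel_measurable M"
      using iE unfolding V_def by (auto intro!: Bochner_Integration.integrable_diff)
    have "AE w in M. real_cond_exp M H V w = 0"
    proof (rule real_cond_exp_eqI)
      fix B assume B: "B \<in> sets H"
      then have BM: "B \<in> sets M" using sub by (auto simp: subalgebra_def)
      note iB = integrable_indicator_real[OF BM]
      have "(\<integral>w. indicator B w * (V w - 0) \<partial>M)
          = (\<integral>w. indicator B w * indicator E w - indicator B w * real_cond_exp M F (indicator E) w \<partial>M)"
        by (simp add: V_def algebra_simps)
      also have "\<dots> = (\<integral>w. indicator B w * indicator E w \<partial>M) - (\<integral>w. indicator B w * real_cond_exp M F (indicator E) w \<partial>M)"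
        by (intro Bochner_Integration.integral_diff integrable_mult_cond_exp_indicator
             integrable_mult_indicator_real sub EM BM iB iE)
      also have "\<dots> = (\<integral>w. indicator E w * indicator B w \<partial>M) - (\<integral>w. indicator E w * real_cond_exp M F (indicator B) w \<partial>M)"
        by (subst real_cond_exp_swap[OF sub(1) EM iB]) (simp add: mult.commute)
      also have "\<dots> = (\<integral>w. indicator E w * indicator B w - indicator E w * real_cond_exp M F (indicator B) w \<partial>M)"
        by (intro Bochner_Integration.integral_diff[symmetric] integrable_mult_cond_exp_indicator
             integrable_mult_indicator_real sub EM BM iB iE)
      also have "\<dots> = 0"
        using ci B E by (simp add: cond_indep_def algebra_simps)
      finally show "(\<integral>w. indicator B w * (V w - 0) \<partial>M) = 0" .
    qed (use sub V in auto)
    moreover have ifV: "integrable M (\<lambda>w. f w * V w)"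
      using integrable_mult_cond_exp_indicator[OF sub(1) EM f(1)] integrable_mult_indicator_real[OF EM f(1)]
      by (simp add: V_def right_diff_distrib)
    ultimately have "(\<integral>w. f w * V w \<partial>M) = 0"
      using V f by (subst H.real_cond_exp_intg(2)[symmetric])
        (auto intro!: integral_eq_zero_AE)
    then have "(\<integral>w. f w * indicator E w \<partial>M) = (\<integral>w. f w * real_cond_exp M F (indicator E) w \<partial>M)"
      using integrable_mult_cond_exp_indicator[OF sub(1) EM f(1)] integrable_mult_indicator_real[OF EM f(1)]
      by (simp add: V_def right_diff_distrib)
    also have "\<dots> = (\<integral>w. real_cond_exp M F f w * indicator E w \<partial>M)"
      by (rule real_cond_exp_swap[OF sub(1) EM f(1)])
    finally show "(\<integral>w. indicator E w * (f w - real_cond_exp M F f w) \<partial>M) = 0"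
      using integrable_mult_indicator_real[OF EM f(1)]
        integrable_mult_indicator_real[OF EM F.real_cond_exp_int(1)[OF f(1)]]
      by (simp add: right_diff_distrib mult.commute)
  qed fact+
qed

text \<open>The other side of the duality: the defect of \<open>B\<close> has zero conditional
  expectation given \<open>G\<close>, hence is orthogonal to every integrable \<open>U\<close> over
  \<open>G\<close>, not only to indicators.\<close>

lemma cond_indep_defect:
  assumes "subalgebra M F" "subalgebra M G" "B \<in> sets M"
    and "\<And>E. E \<in> sets G \<Longrightarrow>
      (\<integral>w. indicator E w * (indicator B w - real_cond_exp M F (indicator B) w) \<partial>M) = 0"
    and U: "U \<in> borel_measurable G" "integrable M U"
  shows "(\<integral>w. U w * (indicator B w - real_cond_exp M F (indicator B) w) \<partial>M) = 0"
proof -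
  interpret F: sigma_finite_subalgebra M F by (rule subalgebra_sigma_finite) fact
  interpret G: sigma_finite_subalgebra M G by (rule subalgebra_sigma_finite) fact
  let ?V = "\<lambda>w. indicator B w - real_cond_exp M F (indicator B) w"
  note iB = integrable_indicator_real[OF assms(3)]
  have V: "integrable M ?V"
    using iB by (auto intro!: Bochner_Integration.integrable_diff)
  have "AE w in M. real_cond_exp M G ?V w = 0"
    by (rule real_cond_exp_eqI) (use assms V in auto)
  moreover have "integrable M (\<lambda>w. U w * ?V w)"
    using integrable_mult_cond_exp_indicator[OF assms(1,3) U(2)] integrable_mult_indicator_real[OF assms(3) U(2)]
    by (simp add: right_diff_distrib)
  ultimately show ?thesis
    using V U by (subst G.real_cond_exp_intg(2)[symmetric]) (auto intro!: integral_eq_zero_AE)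
qed


text \<open>Information already contained in \<open>H\<close> may be moved into the condition. The
  defect relative to \<open>F'\<close>, cut down to an event \<open>C\<close> of \<open>F'\<close>,
  has zero conditional expectation given \<open>F'\<close>, hence given \<open>F\<close> by the
  tower property, hence given \<open>G\<close> because it is \<open>H\<close>-measurable.\<close>

lemma cond_indep_join:
  fixes A :: "'a set set"
  assumes sub: "subalgebra M F" "subalgebra M F'" "subalgebra M H" "subalgebra M G"
      "subalgebra F' F" "subalgebra H F'" "subalgebra G F"
    and ci: "cond_indep F H G" and A: "A \<subseteq> sets G"
  shows "cond_indep F' H (sig M (sets F' \<union> A))"
  unfolding cond_indep_def
proof (intro ballI)
  fix B E assume B: "B \<in> sets H" and E: "E \<in> sets (sig M (sets F' \<union> A))"
  interpret F: sigma_finite_subalgebra M F by (rule subalgebra_sigma_finite) fact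
  interpret F': sigma_finite_subalgebra M F' by (rule subalgebra_sigma_finite) fact
  interpret G: sigma_finite_subalgebra M G by (rule subalgebra_sigma_finite) fact
  have BM: "B \<in> sets M" using B sub by (auto simp: subalgebra_def)
  let ?V = "\<lambda>w. indicator B w - real_cond_exp M F' (indicator B) w"
  note iB = integrable_indicator_real[OF BM]
  have V: "integrable M ?V" using iB by (auto intro!: Bochner_Integration.integrable_diff)
  have VF': "AE w in M. real_cond_exp M F' ?V w = 0"
  proof -
    have "AE w in M. real_cond_exp M F' ?V w
        = real_cond_exp M F' (indicator B) w - real_cond_exp M F' (real_cond_exp M F' (indicator B)) w"
      using iB by (intro F'.real_cond_exp_diff) auto
    moreover have "AE w in M. real_cond_exp M F' (real_cond_exp M F' (indicator B)) w = real_cond_exp M F' (indicator B) w"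
      using iB by (intro F'.real_cond_exp_F_meas) auto
    ultimately show ?thesis by eventually_elim simp
  qed
  show "(\<integral>w. indicator E w * ?V w \<partial>M) = 0"
  proof (rule integral_indicator_join_eq_0[OF sub(2,4) V _ _ E])
    show "sets F' \<union> A \<subseteq> sets F' \<union> sets G" using A by auto
    fix C D assume C: "C \<in> sets F'" and D: "D \<in> sets G"
    have CM: "C \<in> sets M" and DM: "D \<in> sets M" using C D sub by (auto simp: subalgebra_def)
    define f where "f w = indicator C w * ?V w" for w
    have f: "integrable M f" unfolding f_def by (rule integrable_mult_indicator_real(1)[OF CM V])
    have [measurable]: "indicator C \<in> borel_measurable H" "indicator B \<in> borel_measurable H"
      using B C sub(6) by (auto intro!: borel_measurable_indicator simp: subalgebra_def)
    have [measurable]: "real_cond_exp M F' (indicator B) \<in> borel_measurable H"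
      by (rule measurable_from_subalg[OF sub(6)]) simp
    have fH: "f \<in> borel_measurable H" unfolding f_def by measurable
    have "AE w in M. real_cond_exp M G f w = real_cond_exp M F f w"
      by (rule cond_indep_real_cond_exp[OF sub(1,3,4,7) ci f fH])
    moreover have "AE w in M. real_cond_exp M F f w = 0"
    proof -
      have "AE w in M. real_cond_exp M F' f w = indicator C w * real_cond_exp M F' ?V w"
        unfolding f_def using C V f[unfolded f_def] by (intro F'.real_cond_exp_mult) auto
      with VF' have "AE w in M. real_cond_exp M F' f w = 0" by eventually_elim simp
      then have "AE w in M. real_cond_exp M F (real_cond_exp M F' f) w = real_cond_exp M F (\<lambda>_. 0) w"
        by (intro F.real_cond_exp_cong) auto
      moreover have "AE w in M. real_cond_exp M F (real_cond_exp M F' f) w = real_cond_exp M F f w"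
        by (rule F.real_cond_exp_nested_subalg[OF sub(2,5) f])
      moreover have "AE w in M. real_cond_exp M F (\<lambda>_. 0) w = 0"
        by (intro F.real_cond_exp_F_meas) auto
      ultimately show ?thesis by eventually_elim simp
    qed
    ultimately have "AE w in M. real_cond_exp M G f w = 0" by eventually_elim simp
    moreover have "(\<integral>w. indicator D w * f w \<partial>M) = (\<integral>w. indicator D w * real_cond_exp M G f w \<partial>M)"
      using D f by (intro G.real_cond_exp_intg(2)[symmetric] integrable_mult_indicator_real DM) auto
    ultimately have "(\<integral>w. indicator D w * f w \<partial>M) = 0"
      by (auto intro!: integral_eq_zero_AE)
    then show "(\<integral>w. indicator C w * indicator D w * ?V w \<partial>M) = 0"
      by (simp add: f_def mult_ac)
  qed
qed

lemma cond_indep_self: "subalgebra M F \<Longrightarrow> subalgebra M H \<Longrightarrow> cond_indep F H F"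
proof -
  assume sub: "subalgebra M F" "subalgebra M H"
  interpret F: sigma_finite_subalgebra M F by (rule subalgebra_sigma_finite) fact
  have "(\<integral>w. indicator E w * (indicator B w - real_cond_exp M F (indicator B) w) \<partial>M) = 0"
    if B: "B \<in> sets H" and E: "E \<in> sets F" for B E
  proof -
    have M: "B \<in> sets M" "E \<in> sets M" using that sub by (auto simp: subalgebra_def)
    note iB = integrable_indicator_real[OF M(1)]
    have "(\<integral>w. indicator E w * real_cond_exp M F (indicator B) w \<partial>M) = (\<integral>w. indicator E w * indicator B w \<partial>M)"
      using E iB by (intro F.real_cond_exp_intg(2) integrable_mult_indicator_real M) auto
    then show ?thesis
      using integrable_mult_indicator_real(1)[OF M(2) iB]
        integrable_mult_indicator_real(1)[OF M(2) F.real_cond_exp_int(1)[OF iB]]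
      by (simp add: right_diff_distrib)
  qed
  then show ?thesis by (auto simp: cond_indep_def)
qed

lemma cond_indep_mono: "cond_indep F H G \<Longrightarrow> sets G' \<subseteq> sets G \<Longrightarrow> cond_indep F H G'"
  by (auto simp: cond_indep_def)

text \<open>Tested against functions over \<open>HG\<close>, an event of \<open>y\<close> may be
  replaced by its conditional probability, which the kernel property makes
  \<open>G\<close>-measurable. What remains is a test function over \<open>G\<close>, to which the
  defect of \<open>B\<close> is already known to be orthogonal.\<close>

lemma cond_indep_adjoin_kernel:
  assumes sub: "subalgebra M F" "subalgebra M H" "subalgebra M G" "subalgebra G F"
    and HG: "sets H \<subseteq> sets HG" "subalgebra HG G" "subalgebra M HG"
    and ci: "cond_indep F H G" and y: "y \<in> measurable M N"
    and kern: "\<And>S. S \<in> sets N \<Longrightarrow> AE w in M. real_cond_exp M HG (indicator (y -` S \<inter> space M)) w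
        = real_cond_exp M G (indicator (y -` S \<inter> space M)) w"
  shows "cond_indep F H (sig M (sets G \<union> gen_sets M N y))"
  unfolding cond_indep_def
proof (intro ballI)
  fix B E assume B: "B \<in> sets H" and E: "E \<in> sets (sig M (sets G \<union> gen_sets M N y))"
  interpret F: sigma_finite_subalgebra M F by (rule subalgebra_sigma_finite) fact
  interpret HG: sigma_finite_subalgebra M HG by (rule subalgebra_sigma_finite) fact
  interpret G: sigma_finite_subalgebra M G by (rule subalgebra_sigma_finite) fact
  have BM: "B \<in> sets M" using B sub by (auto simp: subalgebra_def)
  let ?V = "\<lambda>w. indicator B w - real_cond_exp M F (indicator B) w"
  note iB = integrable_indicator_real[OF BM]
  have V: "integrable M ?V" using iB by (auto intro!: Bochner_Integration.integrable_diff)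
  show "(\<integral>w. indicator E w * ?V w \<partial>M) = 0"
  proof (rule integral_indicator_join_eq_0[OF sub(3) subalgebra_sig[OF gen_sets_subset[OF y]] V _ _ E])
    show "sets G \<union> gen_sets M N y \<subseteq> sets G \<union> sets (sig M (gen_sets M N y))"
      using sig_superset[OF gen_sets_subset[OF y]] by auto
    fix C D assume C: "C \<in> sets G" and D: "D \<in> sets (sig M (gen_sets M N y))"
    obtain S where S: "S \<in> sets N" "D = y -` S \<inter> space M" using sets_sig_gen_sets[OF y D] by auto
    have CM: "C \<in> sets M" using C sub by (auto simp: subalgebra_def)
    have DM: "D \<in> sets M" using S y by auto
    have CHG: "C \<in> sets HG" using C HG by (auto simp: subalgebra_def)
    note iD = integrable_indicator_real[OF DM]
    have [measurable]: "real_cond_exp M F (indicator B) \<in> borel_measurable HG"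
      by (rule measurable_from_subalg[OF HG(2) measurable_from_subalg[OF sub(4)]]) simp
    have [measurable]: "indicator B \<in> borel_measurable HG" "indicator C \<in> borel_measurable HG"
      using B CHG HG(1) by (auto intro!: borel_measurable_indicator)
    have CV: "(\<lambda>w. indicator C w * ?V w) \<in> borel_measurable HG" by measurable
    have "(\<integral>w. indicator C w * indicator D w * ?V w \<partial>M) = (\<integral>w. (indicator C w * ?V w) * indicator D w \<partial>M)"
      by (simp add: mult_ac)
    also have "\<dots> = (\<integral>w. (indicator C w * ?V w) * real_cond_exp M HG (indicator D) w \<partial>M)"
      using CV V iD by (intro HG.real_cond_exp_intg(2)[symmetric] integrable_mult_indicator_real CM DM) auto
    also have "\<dots> = (\<integral>w. (indicator C w * ?V w) * real_cond_exp M G (indicator D) w \<partial>M)"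
    proof (rule integral_cong_AE)
      show "AE w in M. indicator C w * ?V w * real_cond_exp M HG (indicator D) w
          = indicator C w * ?V w * real_cond_exp M G (indicator D) w"
        using kern[OF S(1)] unfolding S(2) by eventually_elim simp
    qed (use CM BM in measurable)
    also have "\<dots> = (\<integral>w. (indicator C w * real_cond_exp M G (indicator D) w) * ?V w \<partial>M)"
      by (simp add: mult_ac)
    also have "\<dots> = 0"
    proof (rule cond_indep_defect[OF sub(1,3) BM])
      show "(\<lambda>w. indicator C w * real_cond_exp M G (indicator D) w) \<in> borel_measurable G"
        using C by measurable
      show "integrable M (\<lambda>w. indicator C w * real_cond_exp M G (indicator D) w)"
        using iD by (intro integrable_mult_indicator_real CM) auto
    qed (use ci B in \<open>auto simp: cond_indep_def\<close>)
    finally show "(\<integral>w. indicator C w * indicator D w * ?V w \<partial>M) = 0" .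
  qed
qed

text \<open>Induction over time with two alternating moves: the kernel property adjoins the newest
  output (\<open>cond_indep_adjoin_kernel\<close>), and the next sample, being part of the source,
  is moved into the condition (\<open>cond_indep_join\<close>).\<close>

lemma causal_kernel_cond_indep:
  assumes past: "\<And>k. past k \<subseteq> sets M" "\<And>k. past k \<subseteq> Src" "mono past" and Src: "Src \<subseteq> sets M"
    and ck: "causal_kernel M N Src past y"
  shows "cond_indep (sig M (past k)) (sig M Src) (sig M (past k \<union> (\<Union>j\<le>k. gen_sets M N (y j))))"
proof -
  have y: "y k \<in> measurable M N" for k using ck by (auto simp: causal_kernel_def)
  let ?g = "\<lambda>k. gen_sets M N (y k)"
  have g: "?g k \<subseteq> sets M" for k by (rule gen_sets_subset[OF y])
  have gU: "(\<Union>j\<in>J. ?g j) \<subseteq> sets M" for J using g by blast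
  have kern: "AE w in M. real_cond_exp M (sig M (Src \<union> (\<Union>j<k. ?g j))) (indicator (y k -` S \<inter> space M)) w
      = real_cond_exp M (sig M (past k \<union> (\<Union>j<k. ?g j))) (indicator (y k -` S \<inter> space M)) w"
    if "S \<in> sets N" for k S
    using ck that unfolding causal_kernel_def by blast
  have step: "cond_indep (sig M (past k)) (sig M Src) (sig M (past k \<union> (\<Union>j\<le>k. ?g j)))"
    if pre: "cond_indep (sig M (past k)) (sig M Src) (sig M (past k \<union> (\<Union>j<k. ?g j)))" for k
  proof -
    have X: "past k \<union> (\<Union>j<k. ?g j) \<subseteq> sets M" "Src \<union> (\<Union>j<k. ?g j) \<subseteq> sets M"
      using past(1) gU Src by blast+
    let ?G = "sig M (past k \<union> (\<Union>j<k. ?g j))" and ?HG = "sig M (Src \<union> (\<Union>j<k. ?g j))"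
    have 1: "subalgebra ?G (sig M (past k))"
      by (rule subalgebra_sig_mono[OF Un_upper1 X(1)])
    have 2: "sets (sig M Src) \<subseteq> sets ?HG"
      by (rule sets_sig_mono[OF Un_upper1 X(2)])
    have 3: "subalgebra ?HG ?G"
      by (rule subalgebra_sig_mono[OF Un_mono[OF past(2) order_refl] X(2)])
    have "cond_indep (sig M (past k)) (sig M Src) (sig M (sets ?G \<union> ?g k))"
      by (rule cond_indep_adjoin_kernel[OF subalgebra_sig[OF past(1)] subalgebra_sig[OF Src] subalgebra_sig[OF X(1)]
          1 2 3 subalgebra_sig[OF X(2)] pre y[of k] kern])
    moreover have "sets (sig M (past k \<union> (\<Union>j\<le>k. ?g j)))
        \<subseteq> sets (sig M (sets (sig M (past k \<union> (\<Union>j<k. ?g j))) \<union> ?g k))"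
    proof -
      have "past k \<union> (\<Union>j\<le>k. ?g j) \<subseteq> sets (sig M (past k \<union> (\<Union>j<k. ?g j))) \<union> ?g k"
        using sig_superset[OF X(1)] unfolding ivl_disj_un_singleton(2)[symmetric] by blast
      moreover have "sets (sig M (past k \<union> (\<Union>j<k. ?g j))) \<union> ?g k \<subseteq> sets M"
        using subalgebra_sig[OF X(1)] g by (auto simp: subalgebra_def)
      ultimately show ?thesis by (rule sets_sig_mono)
    qed
    ultimately show ?thesis by (rule cond_indep_mono)
  qed
  show ?thesis
  proof (induction k)
    case 0
    show ?case by (rule step) (auto intro!: cond_indep_self subalgebra_sig past Src)
  next
    case (Suc k)
    show ?case
    proof (rule step)
      have X: "past k \<union> (\<Union>j\<le>k. ?g j) \<subseteq> sets M" using past(1) gU by blast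
      have pp: "past k \<subseteq> past (Suc k)" using past(3) by (simp add: monoD)
      have "cond_indep (sig M (past (Suc k))) (sig M Src) (sig M (sets (sig M (past (Suc k))) \<union> (\<Union>j\<le>k. ?g j)))"
        using sig_superset[OF X]
        by (intro cond_indep_join[OF subalgebra_sig[OF past(1)] subalgebra_sig[OF past(1)] subalgebra_sig[OF Src]
            subalgebra_sig[OF X] subalgebra_sig_mono[OF pp past(1)] subalgebra_sig_mono[OF past(2) Src]
            subalgebra_sig_mono[OF Un_upper1 X] Suc]) blast
      moreover have "sets (sig M (past (Suc k) \<union> (\<Union>j<Suc k. ?g j))) \<subseteq> sets (sig M (sets (sig M (past (Suc k))) \<union> (\<Union>j\<le>k. ?g j)))"
      proof -
        have "past (Suc k) \<union> (\<Union>j<Suc k. ?g j) \<subseteq> sets (sig M (past (Suc k))) \<union> (\<Union>j\<le>k. ?g j)"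
          using sig_superset[OF past(1)[of "Suc k"]] unfolding lessThan_Suc_atMost by blast
        moreover have "sets (sig M (past (Suc k))) \<union> (\<Union>j\<le>k. ?g j) \<subseteq> sets M"
          using subalgebra_sig[OF past(1)] gU by (auto simp: subalgebra_def)
        ultimately show ?thesis by (rule sets_sig_mono)
      qed
      ultimately show "cond_indep (sig M (past (Suc k))) (sig M Src) (sig M (past (Suc k) \<union> (\<Union>j<Suc k. ?g j)))"
        by (rule cond_indep_mono)
    qed
  qed
qed

text \<open>The way back. The history of \<open>z\<close> may reveal less than \<open>Y k\<close>,
  so a kernel property of the original outputs does not transfer literally; conditional independence
  given the past does.\<close>

lemma causal_kernel_of_cond_indep:
  assumes past: "\<And>k. past k \<subseteq> sets M" "\<And>k. past k \<subseteq> Src" and Src: "Src \<subseteq> sets M"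
    and Y: "\<And>k. subalgebra M (Y k)" "\<And>k. past k \<subseteq> sets (Y k)" "\<And>j k. j \<le> k \<Longrightarrow> z j \<in> measurable (Y k) N"
    and ci: "\<And>k. cond_indep (sig M (past k)) (sig M Src) (Y k)"
  shows "causal_kernel M N Src past z"
  unfolding causal_kernel_def
proof (intro conjI allI ballI)
  show zM: "z k \<in> measurable M N" for k by (rule measurable_from_subalg[OF Y(1) Y(3)[OF order_refl]])
  fix k S assume S: "S \<in> sets N"
  let ?g = "\<lambda>k. gen_sets M N (z k)"
  let ?W = "z k -` S \<inter> space M" and ?Z = "\<Union>j<k. ?g j"
  let ?G = "sig M (past k \<union> ?Z)" and ?F = "sig M (past k)" and ?HG = "sig M (Src \<union> ?Z)"
  have spY: "space (Y k) = space M" using Y(1) by (auto simp: subalgebra_def)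
  have ZY: "?Z \<subseteq> sets (Y k)"
  proof (rule UN_least)
    fix j assume "j \<in> {..<k}"
    then show "?g j \<subseteq> sets (Y k)" by (intro gen_sets_subset_subalgebra[OF Y(3) spY]) auto
  qed
  have YM: "sets (Y k) \<subseteq> sets M" using Y(1) by (auto simp: subalgebra_def)
  have ZM: "?Z \<subseteq> sets M" using ZY YM by auto
  have X: "past k \<union> ?Z \<subseteq> sets M" "Src \<union> ?Z \<subseteq> sets M" using past ZM Src by auto
  have WY: "?W \<in> sets (Y k)" using measurable_sets[OF Y(3) S, of k k] spY by simp
  then have WM: "?W \<in> sets M" using YM by auto
  have GY: "subalgebra (Y k) ?G" using X(1) Y(2) ZY spY by (intro subalgebra_sig_least) auto
  interpret F: sigma_finite_subalgebra M ?F by (intro subalgebra_sigma_finite subalgebra_sig past)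
  interpret G: sigma_finite_subalgebra M ?G by (intro subalgebra_sigma_finite subalgebra_sig X)
  note iW = integrable_indicator_real[OF WM]
  let ?f = "\<lambda>w. indicator ?W w - real_cond_exp M ?G (indicator ?W) w"
  have if': "integrable M ?f" using iW by (auto intro!: Bochner_Integration.integrable_diff)
  show "AE w in M. real_cond_exp M ?HG (indicator ?W) w = real_cond_exp M ?G (indicator ?W) w"
  proof (rule real_cond_exp_eqI)
    show "subalgebra M ?HG" by (intro subalgebra_sig X)
    show "integrable M (indicator ?W :: 'a \<Rightarrow> real)" by (rule iW)
    then show "integrable M (real_cond_exp M ?G (indicator ?W))" by auto
    show "real_cond_exp M ?G (indicator ?W) \<in> borel_measurable ?HG"
      using past by (intro measurable_from_subalg[OF subalgebra_sig_mono[OF _ X(2), of "past k \<union> ?Z"]]) auto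
    fix E assume E: "E \<in> sets ?HG"
    show "(\<integral>w. indicator E w * ?f w \<partial>M) = 0"
    proof (rule integral_indicator_join_eq_0[OF subalgebra_sig[OF Src] subalgebra_sig[OF ZM] if' _ _ E])
      show "Src \<union> ?Z \<subseteq> sets (sig M Src) \<union> sets (sig M ?Z)"
        using sig_superset[OF Src] sig_superset[OF ZM] by blast
      fix B D assume B: "B \<in> sets (sig M Src)" and D: "D \<in> sets (sig M ?Z)"
      have BM: "B \<in> sets M" using B subalgebra_sig[OF Src] by (auto simp: subalgebra_def)
      have DG: "D \<in> sets ?G" using D subalgebra_sig_mono[of ?Z "past k \<union> ?Z" M] X by (auto simp: subalgebra_def)
      then have DM: "D \<in> sets M" using subalgebra_sig[OF X(1)] by (auto simp: subalgebra_def)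
      have DY: "D \<in> sets (Y k)" using DG GY by (auto simp: subalgebra_def)
      \<comment> \<open>\<open>U\<close> is measurable over \<open>Y k\<close>, so \<open>B\<close>
        may be replaced by its conditional probability given the past. That factor, cut down to
        \<open>D\<close>, is measurable over \<open>?G\<close>, and the defect of \<open>?W\<close>
        is orthogonal to it.\<close>
      define U where "U w = indicator D w * ?f w" for w
      have U: "integrable M U" unfolding U_def by (rule integrable_mult_indicator_real(1)[OF DM if'])
      have [measurable]: "real_cond_exp M ?G (indicator ?W) \<in> borel_measurable (Y k)"
        by (rule measurable_from_subalg[OF GY]) simp
      have UY: "U \<in> borel_measurable (Y k)" unfolding U_def using DY WY by measurable
      have "(\<integral>w. U w * (indicator B w - real_cond_exp M ?F (indicator B) w) \<partial>M) = 0"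
        by (rule cond_indep_defect[OF subalgebra_sig[OF past(1)] Y(1) BM _ UY U])
          (use ci B in \<open>auto simp: cond_indep_def\<close>)
      then have "(\<integral>w. indicator B w * U w \<partial>M) = (\<integral>w. real_cond_exp M ?F (indicator B) w * U w \<partial>M)"
        using integrable_mult_cond_exp_indicator[OF subalgebra_sig[OF past(1)] BM U]
          integrable_mult_indicator_real[OF BM U]
        by (simp add: right_diff_distrib mult.commute)
      also have "\<dots> = 0"
      proof -
        let ?h = "\<lambda>w. real_cond_exp M ?F (indicator B) w * indicator D w"
        have [measurable]: "real_cond_exp M ?F (indicator B) \<in> borel_measurable ?G"
          by (rule measurable_from_subalg[OF subalgebra_sig_mono[OF _ X(1)]]) auto
        have hG: "?h \<in> borel_measurable ?G" using DG by measurable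
        have ih: "integrable M ?h"
          by (intro integrable_mult_indicator_real DM F.real_cond_exp_int integrable_indicator_real BM)
        have ihW: "integrable M (\<lambda>w. ?h w * indicator ?W w)" by (intro integrable_mult_indicator_real WM ih)
        have ihG: "integrable M (\<lambda>w. ?h w * real_cond_exp M ?G (indicator ?W) w)"
          by (rule integrable_mult_cond_exp_indicator[OF subalgebra_sig[OF X(1)] WM ih])
        have "(\<integral>w. ?h w * real_cond_exp M ?G (indicator ?W) w \<partial>M) = (\<integral>w. ?h w * indicator ?W w \<partial>M)"
          by (rule G.real_cond_exp_intg(2)[OF ihW hG]) (use WM in auto)
        then show ?thesis
          using ihW ihG by (simp add: U_def right_diff_distrib mult.assoc)
      qed
      finally show "(\<integral>w. indicator B w * indicator D w * ?f w \<partial>M) = 0" by (simp add: U_def mult_ac)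
    qed
  qed
qed

text \<open>The conditional probability given the larger source equals one that is measurable over
  the smaller source, so conditioning once more on the latter leaves it unchanged.\<close>

lemma causal_kernel_restrict_source:
  assumes past: "\<And>k. past k \<subseteq> Src'" and Src: "Src' \<subseteq> Src" "Src \<subseteq> sets M"
    and ck: "causal_kernel M N Src past y"
  shows "causal_kernel M N Src' past y"
  unfolding causal_kernel_def
proof (intro conjI allI ballI)
  show yM: "y k \<in> measurable M N" for k using ck by (auto simp: causal_kernel_def)
  fix k S assume S: "S \<in> sets N"
  let ?Z = "\<Union>j<k. gen_sets M N (y j)" and ?W = "y k -` S \<inter> space M"
  let ?G = "sig M (past k \<union> ?Z)" and ?H = "sig M (Src' \<union> ?Z)" and ?HG = "sig M (Src \<union> ?Z)"
  have ZM: "?Z \<subseteq> sets M" using gen_sets_subset[OF yM] by blast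
  have X: "past k \<union> ?Z \<subseteq> sets M" "Src' \<union> ?Z \<subseteq> sets M" "Src \<union> ?Z \<subseteq> sets M"
    using past Src ZM by blast+
  interpret H: sigma_finite_subalgebra M ?H by (intro subalgebra_sigma_finite subalgebra_sig X)
  interpret G: sigma_finite_subalgebra M ?G by (intro subalgebra_sigma_finite subalgebra_sig X)
  have iW: "integrable M (indicator ?W :: 'a \<Rightarrow> real)" using S yM by (intro integrable_indicator_real) auto
  have "AE w in M. real_cond_exp M ?H (real_cond_exp M ?HG (indicator ?W)) w = real_cond_exp M ?H (indicator ?W) w"
    using Src by (intro H.real_cond_exp_nested_subalg subalgebra_sig subalgebra_sig_mono X iW) auto
  moreover have "AE w in M. real_cond_exp M ?H (real_cond_exp M ?HG (indicator ?W)) w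
      = real_cond_exp M ?H (real_cond_exp M ?G (indicator ?W)) w"
    using ck S by (intro H.real_cond_exp_cong) (auto simp: causal_kernel_def)
  moreover have "AE w in M. real_cond_exp M ?H (real_cond_exp M ?G (indicator ?W)) w = real_cond_exp M ?G (indicator ?W) w"
  proof (rule H.real_cond_exp_F_meas)
    show "real_cond_exp M ?G (indicator ?W) \<in> borel_measurable ?H"
      using past by (intro measurable_from_subalg[OF subalgebra_sig_mono[OF _ X(2), of "past k \<union> ?Z"]]) auto
  qed (use iW in auto)
  ultimately show "AE w in M. real_cond_exp M ?H (indicator ?W) w = real_cond_exp M ?G (indicator ?W) w"
    by eventually_elim simp
qed

end

section \<open>Codeword length and mutual information\<close>

lemma theta_0 [simp]: "theta 0 = 0"
  by (simp add: theta_def)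

lemma theta_pos_eq: "x > 0 \<Longrightarrow> theta x = x + (1 + x) * log 2 (1 + x) - x * log 2 x"
  by (simp add: theta_def)

lemma theta_strict_mono_pos:
  assumes "0 < x" "x < y"
  shows "theta x < theta y"
proof -
  have "x + (1 + x) * log 2 (1 + x) - x * log 2 x < y + (1 + y) * log 2 (1 + y) - y * log 2 y"
  proof (rule DERIV_pos_imp_increasing[OF assms(2)])
    fix z assume z: "x \<le> z" "z \<le> y"
    have "((\<lambda>x. x + (1 + x) * log 2 (1 + x) - x * log 2 x) has_real_derivative
        1 + log 2 (1 + z) - log 2 z) (at z)"
      using z assms by (auto intro!: derivative_eq_intros simp: divide_simps log_def)
    moreover have "1 + log 2 (1 + z) - log 2 z > 0"
    proof -
      have "log 2 z \<le> log 2 (1 + z)" using z assms by (subst log_le_cancel_iff) auto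
      then show ?thesis by simp
    qed
    ultimately show "\<exists>d. ((\<lambda>x. x + (1 + x) * log 2 (1 + x) - x * log 2 x) has_real_derivative d) (at z) \<and> d > 0"
      by blast
  qed
  then show ?thesis using assms by (simp add: theta_pos_eq)
qed

text \<open>Supplies the upper endpoint \<open>y\<close> for the intermediate value theorem in
  \<open>theta_inv_props\<close>, and positivity to the right of \<open>0\<close>.\<close>

lemma theta_ge: "0 \<le> x \<Longrightarrow> x \<le> theta x"
proof (cases "x = 0")
  case False
  assume "0 \<le> x"
  with False have x: "x > 0" by simp
  have "log 2 x \<le> log 2 (1 + x)" "0 \<le> log 2 (1 + x)" using x by auto
  moreover from this have "x * log 2 x \<le> x * log 2 (1 + x)" using x by (intro mult_left_mono) auto
  moreover have "(1 + x) * log 2 (1 + x) = log 2 (1 + x) + x * log 2 (1 + x)" by (simp add: distrib_right)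
  ultimately show ?thesis unfolding theta_pos_eq[OF x] by linarith
qed simp

lemma theta_strict_mono: "0 \<le> x \<Longrightarrow> x < y \<Longrightarrow> theta x < theta y"
  using theta_strict_mono_pos[of x y] theta_ge[of y] by (cases "x = 0") auto

lemma continuous_on_theta: "continuous_on {0..} theta"
  unfolding continuous_on_def
proof
  fix x :: real assume x: "x \<in> {0..}"
  show "(theta \<longlongrightarrow> theta x) (at x within {0..})"
  proof (cases "x = 0")
    case True
    have "((\<lambda>x::real. x + (1 + x) * log 2 (1 + x) - x * log 2 x) \<longlongrightarrow> 0) (at_right 0)"
      unfolding log_def by real_asymp
    then have "(theta \<longlongrightarrow> 0) (at_right 0)"
      by (rule Lim_transform_eventually)
         (auto simp: eventually_at_right_less theta_pos_eq intro!: eventually_at_right_less[THEN eventually_mono])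
    moreover have "at (0::real) within {0..} = at_right 0"
      by (rule at_within_nhd[of _ "UNIV"]) auto
    ultimately show ?thesis using True by simp
  next
    case False
    with x have x: "x > 0" by auto
    have "((\<lambda>x. x + (1 + x) * log 2 (1 + x) - x * log 2 x) \<longlongrightarrow> theta x) (at x)"
      unfolding theta_pos_eq[OF x] using x by (intro tendsto_intros) auto
    moreover have "eventually (\<lambda>z. z > 0) (at x)"
      using x order_tendstoD(1)[OF tendsto_ident_at] by blast
    ultimately have "(theta \<longlongrightarrow> theta x) (at x)"
      by (rule Lim_transform_eventually[OF _ eventually_mono]) (simp add: theta_pos_eq)
    then show ?thesis by (rule tendsto_within_subset) simp
  qed
qed

lemma theta_inv_props:
  assumes "0 \<le> y"
  shows "0 \<le> theta_inv y" "theta (theta_inv y) = y"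
proof -
  have "\<exists>x. 0 \<le> x \<and> x \<le> y \<and> theta x = y"
    using assms theta_ge[OF assms] by (intro IVT' continuous_on_subset[OF continuous_on_theta]) auto
  then obtain x where x: "0 \<le> x" "theta x = y" by blast
  have "0 \<le> theta_inv y \<and> theta (theta_inv y) = y"
    unfolding theta_inv_def
  proof (rule theI)
    show "0 \<le> x \<and> theta x = y" using x by simp
    fix z assume "0 \<le> z \<and> theta z = y"
    then show "z = x" using x theta_strict_mono[of x z] theta_strict_mono[of z x] by (cases z x rule: linorder_cases) auto
  qed
  then show "0 \<le> theta_inv y" "theta (theta_inv y) = y" by auto
qed

lemma theta_inv_e_le:
  assumes "0 \<le> r" "r \<le> ereal (theta L)" "0 \<le> L"
  shows "theta_inv_e r \<le> ereal L"
proof (cases r)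
  case (real y)
  then have y: "0 \<le> y" "y \<le> theta L" using assms by auto
  have "theta_inv y \<le> L"
    using theta_strict_mono[of L "theta_inv y"] theta_inv_props[OF y(1)] y assms(3) by (cases "theta_inv y \<le> L") auto
  then show ?thesis by (simp add: real theta_inv_e_def)
qed (use assms in auto)

text \<open>A word distribution with geometric length, uniform on words of the same length. It attains
  the maximal entropy \<open>theta L\<close> among all distributions on binary words of mean length \<open>L\<close>.\<close>

definition word_pmf :: "real \<Rightarrow> bool list pmf" where
  "word_pmf L = bind_pmf (geometric_pmf (1 / (1 + L))) (\<lambda>n. pmf_of_set {w. length w = n})"

lemma pmf_word_pmf:
  assumes "L > 0"
  shows "pmf (word_pmf L) w = (L / (1 + L)) ^ length w * (1 / (1 + L)) / 2 ^ length w"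
proof -
  have fin: "finite {w::bool list. length w = n}" and card: "card {w::bool list. length w = n} = 2 ^ n" for n
    using finite_lists_length_eq[of "UNIV::bool set" n] card_lists_length_eq[of "UNIV::bool set" n]
    by (simp_all add: card_UNIV_bool)
  have ne: "{w::bool list. length w = n} \<noteq> {}" for n
    using card[of n] by (metis card.empty power_not_zero zero_neq_numeral)
  have "pmf (word_pmf L) w = (\<integral>n. pmf (pmf_of_set {w. length w = n}) w \<partial>geometric_pmf (1 / (1 + L)))"
    by (simp add: word_pmf_def pmf_bind)
  also have "\<dots> = (\<Sum>n\<in>{length w}. pmf (pmf_of_set {w. length w = n}) w * pmf (geometric_pmf (1 / (1 + L))) n)"
    by (rule integral_measure_pmf_real) (auto simp: pmf_of_set[OF ne fin] indicator_def split: if_splits)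
  also have "\<dots> = (1 - 1 / (1 + L)) ^ length w * (1 / (1 + L)) / 2 ^ length w"
    using assms by (simp add: pmf_of_set[OF ne fin] card)
  also have "1 - 1 / (1 + L) = L / (1 + L)" using assms by (simp add: field_simps)
  finally show ?thesis .
qed

lemma pmf_replicate_pmf: "length xs = n \<Longrightarrow> pmf (replicate_pmf n p) xs = (\<Prod>k<n. pmf p (xs ! k))"
proof (induction n arbitrary: xs)
  case (Suc n)
  then obtain y ys where xs: "xs = y # ys" "length ys = n" by (cases xs) auto
  have "replicate_pmf (Suc n) p = map_pmf (\<lambda>(x, xs). x # xs) (pair_pmf p (replicate_pmf n p))"
    by (simp add: map_pmf_def pair_pmf_def bind_assoc_pmf bind_return_pmf)
  then have "pmf (replicate_pmf (Suc n) p) xs = pmf (pair_pmf p (replicate_pmf n p)) (y, ys)"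
    unfolding xs using pmf_map_inj'[of "\<lambda>(x, xs). x # xs" "pair_pmf p (replicate_pmf n p)" "(y, ys)"]
    by (simp add: inj_on_def split_beta prod_eq_iff)
  also have "\<dots> = (\<Prod>k<Suc n. pmf p (xs ! k))"
    using Suc.IH[OF xs(2)] by (simp only: pmf_pair prod.lessThan_Suc_shift) (simp add: xs(1))
  finally show ?case .
qed simp

text \<open>Affine in the length, so its expectation under any codeword distribution depends only on
  the mean length; at mean \<open>L\<close> it is exactly \<open>theta L\<close>.\<close>

lemma neg_log_word_pmf:
  assumes "L > 0"
  shows "- log 2 (pmf (word_pmf L) w) = log 2 (1 + L) + real (length w) * (1 + log 2 (1 + L) - log 2 L)"
proof -
  have "log 2 (pmf (word_pmf L) w) = log 2 ((L / (1 + L)) ^ length w) + log 2 (1 / (1 + L)) - log 2 (2 ^ length w)"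
    unfolding pmf_word_pmf[OF assms] using assms by (subst log_divide) (auto simp: log_mult simp del: times_divide_eq_right)
  also have "\<dots> = real (length w) * (log 2 L - log 2 (1 + L)) - log 2 (1 + L) - real (length w)"
    using assms by (simp add: log_nat_power log_divide)
  finally show ?thesis by (simp add: algebra_simps)
qed

lemma pmf_word_pmf_pos: "L > 0 \<Longrightarrow> pmf (word_pmf L) w > 0"
  by (simp add: pmf_word_pmf)

text \<open>\<open>ln u \<le> u - 1\<close> at \<open>u = q / p\<close>. The linear remainder is
  kept because its sum over a partition is at most zero.\<close>

lemma gibbs_term: "0 < p \<Longrightarrow> 0 < q \<Longrightarrow> - p * log 2 p \<le> - p * log 2 q + (q - p) / ln (2::real)"
proof -
  assume p: "0 < (p::real)" and q: "0 < q"
  have "ln (q / p) \<le> q / p - 1" using p q by (intro ln_le_minus_one) auto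
  then have "p * ln (q / p) \<le> p * (q / p - 1)" using p by (intro mult_left_mono) auto
  then have "p * ln q - p * ln p \<le> q - p" using p q by (simp add: ln_div algebra_simps)
  then have "(p * ln q - p * ln p) / ln 2 \<le> (q - p) / ln 2" by (intro divide_right_mono) auto
  then show ?thesis by (simp add: log_def diff_divide_distrib)
qed

section \<open>Mutual information, entropy and cross entropy\<close>

context prob_space
begin

lemma mutual_info_nonneg:
  assumes "subalgebra M F" "subalgebra M H"
  shows "0 \<le> mutual_info M (sets F) (sets H)"
proof -
  have "fin_part M (sets F) {space M}" "fin_part M (sets H) {space M}"
    using assms sets.top[of F] sets.top[of H] by (auto simp: fin_part_def subalgebra_def)
  then have "ereal 0 \<le> mutual_info M (sets F) (sets H)"
    unfolding mutual_info_def by (intro SUP_upper2[where i="({space M}, {space M})"]) (auto simp: prob_space Let_def)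
  then show ?thesis by (simp add: zero_ereal_def)
qed

text \<open>Each joint probability is at most \<open>prob E\<close>, so the ratio in the logarithm
  is at most \<open>1 / prob F\<close>; summing out the cells \<open>E\<close> leaves the entropy of
  the partition \<open>Q\<close>.\<close>

lemma partition_info_le_entropy:
  assumes GM: "G \<subseteq> events" and HM: "H \<subseteq> events" and P: "fin_part M G P" and Q: "fin_part M H Q"
  shows "(\<Sum>E\<in>P. \<Sum>F\<in>Q. (let p = prob (E \<inter> F) in if p = 0 then 0 else p * log 2 (p / (prob E * prob F))))
    \<le> (\<Sum>F\<in>Q. - prob F * log 2 (prob F))"
proof -
  have PM: "E \<in> events" if "E \<in> P" for E using that P GM by (auto simp: fin_part_def)
  have QM: "F \<in> events" if "F \<in> Q" for F using that Q HM by (auto simp: fin_part_def)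
  have finP: "finite P" and finQ: "finite Q" using P Q by (auto simp: fin_part_def)
  have "(\<Sum>E\<in>P. \<Sum>F\<in>Q. (let p = prob (E \<inter> F) in if p = 0 then 0 else p * log 2 (p / (prob E * prob F))))
      \<le> (\<Sum>E\<in>P. \<Sum>F\<in>Q. prob (E \<inter> F) * - log 2 (prob F))"
  proof (intro sum_mono)
    fix E F assume E: "E \<in> P" and F: "F \<in> Q"
    let ?p = "prob (E \<inter> F)"
    show "(let p = ?p in if p = 0 then 0 else p * log 2 (p / (prob E * prob F))) \<le> ?p * - log 2 (prob F)"
    proof (cases "?p = 0")
      case False
      then have p: "?p > 0" using measure_nonneg[of M "E \<inter> F"] by linarith
      have le: "?p \<le> prob E" "?p \<le> prob F" using PM[OF E] QM[OF F] by (auto intro!: finite_measure_mono)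
      have pos: "prob E > 0" "prob F > 0" using p le by linarith+
      have "log 2 (?p / (prob E * prob F)) \<le> - log 2 (prob F)"
        using p pos le by (simp add: log_divide log_mult)
      from mult_left_mono[OF this less_imp_le[OF p]] show ?thesis using p by (simp add: Let_def)
    qed (simp add: Let_def)
  qed
  also have "\<dots> = (\<Sum>F\<in>Q. (\<Sum>E\<in>P. prob (E \<inter> F)) * - log 2 (prob F))"
    by (subst sum.swap) (simp only: sum_distrib_right)
  also have "\<dots> = (\<Sum>F\<in>Q. - prob F * log 2 (prob F))"
  proof (intro sum.cong refl)
    fix F assume F: "F \<in> Q"
    have "prob F = prob (\<Union>E\<in>P. E \<inter> F)"
      using P sets.sets_into_space[OF QM[OF F]] by (intro arg_cong[where f=prob]) (auto simp: fin_part_def)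
    also have "\<dots> = (\<Sum>E\<in>P. prob (E \<inter> F))"
    proof (rule finite_measure_finite_Union[OF finP])
      show "disjoint_family_on (\<lambda>E. E \<inter> F) P"
        using P unfolding fin_part_def disjoint_family_on_def disjoint_def by blast
    qed (use PM QM[OF F] in auto)
    finally show "(\<Sum>E\<in>P. prob (E \<inter> F)) * - log 2 (prob F) = - prob F * log 2 (prob F)" by simp
  qed
  finally show ?thesis .
qed

text \<open>By \<open>sat\<close>, events of \<open>H\<close> are unions of fibres of
  \<open>h\<close>. Disjoint cells therefore have disjoint images, whose total mass under
  \<open>q\<close> is at most one, as Gibbs' inequality needs; within a cell,
  \<open>pmf q (h w)\<close> is at most the mass of the image of the cell.\<close>

lemma entropy_le_cross_entropy:
  fixes q :: "'b pmf" and h :: "'a \<Rightarrow> 'b"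
  assumes HM: "H \<subseteq> events" and Q: "fin_part M H Q"
    and sat: "\<And>F w v. F \<in> H \<Longrightarrow> w \<in> F \<Longrightarrow> v \<in> space M \<Longrightarrow> h v = h w \<Longrightarrow> v \<in> F"
    and pos: "\<And>w. w \<in> space M \<Longrightarrow> pmf q (h w) > 0"
    and int: "integrable M (\<lambda>w. - log 2 (pmf q (h w)))"
  shows "(\<Sum>F\<in>Q. - prob F * log 2 (prob F)) \<le> (\<integral>w. - log 2 (pmf q (h w)) \<partial>M)"
proof -
  let ?q = "\<lambda>F. measure_pmf.prob q (h ` F)"
  have finQ: "finite Q" and QU: "\<Union>Q = space M" and dQ: "disjoint Q" and QH: "Q \<subseteq> H"
    using Q by (auto simp: fin_part_def)
  have QM: "F \<in> events" if "F \<in> Q" for F using that QH HM by auto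
  have Qsp: "F \<subseteq> space M" if "F \<in> Q" for F using QU that by auto
  have qpt: "pmf q (h w) \<le> ?q F" if "w \<in> F" for w F
    unfolding measure_pmf_single[symmetric] using that by (intro measure_pmf.finite_measure_mono) auto
  have "(\<Sum>F\<in>Q. - prob F * log 2 (prob F)) \<le> (\<Sum>F\<in>Q. - prob F * log 2 (?q F) + (?q F - prob F) / ln 2)"
  proof (rule sum_mono)
    fix F assume F: "F \<in> Q"
    show "- prob F * log 2 (prob F) \<le> - prob F * log 2 (?q F) + (?q F - prob F) / ln 2"
    proof (cases "prob F = 0")
      case False
      then have "prob F > 0" using measure_nonneg[of M F] by linarith
      \<comment> \<open>A cell of positive probability is nonempty, and a single point already gives
        its image positive mass.\<close>
      moreover obtain w where "w \<in> F" using False by (metis all_not_in_conv measure_empty)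
      then have "?q F > 0" using qpt[of w F] pos[of w] Qsp[OF F] by (auto intro: less_le_trans)
      ultimately show ?thesis by (rule gibbs_term)
    qed simp
  qed
  also have "\<dots> = (\<Sum>F\<in>Q. - prob F * log 2 (?q F)) + ((\<Sum>F\<in>Q. ?q F) - (\<Sum>F\<in>Q. prob F)) / ln 2"
    by (simp only: sum.distrib sum_subtractf sum_divide_distrib[symmetric])
  also have "\<dots> \<le> (\<Sum>F\<in>Q. - prob F * log 2 (?q F))"
  proof -
    have "h ` F \<inter> h ` F' = {}" if FF: "F \<in> Q" "F' \<in> Q" "F \<noteq> F'" for F F'
    proof -
      have "F \<inter> F' = {}" using dQ FF by (auto simp: disjoint_def)
      moreover have "w \<in> F" if "w \<in> F'" "v \<in> F" "h w = h v" for v w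
        using sat[of F v w] that FF QH Qsp by blast
      ultimately show ?thesis by (auto; metis disjoint_iff)
    qed
    then have "(\<Sum>F\<in>Q. ?q F) = measure_pmf.prob q (\<Union>F\<in>Q. h ` F)"
      by (intro measure_pmf.finite_measure_finite_Union[symmetric] finQ) (auto simp: disjoint_family_on_def)
    moreover have "(\<Sum>F\<in>Q. prob F) = prob (\<Union>F\<in>Q. F)"
      using dQ QM by (intro finite_measure_finite_Union[symmetric] finQ) (auto simp: disjoint_family_on_def disjoint_def)
    ultimately have "(\<Sum>F\<in>Q. ?q F) - (\<Sum>F\<in>Q. prob F) \<le> 0"
      using QU by (simp add: prob_space measure_pmf.prob_le_1)
    then show ?thesis by (simp add: divide_nonpos_pos)
  qed
  also have "\<dots> \<le> (\<Sum>F\<in>Q. \<integral>w. indicator F w * - log 2 (pmf q (h w)) \<partial>M)"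
  proof (rule sum_mono)
    fix F assume F: "F \<in> Q"
    have "- prob F * log 2 (?q F) = (\<integral>w. indicator F w * - log 2 (?q F) \<partial>M)"
      using QM[OF F] by simp
    also have "\<dots> \<le> (\<integral>w. indicator F w * - log 2 (pmf q (h w)) \<partial>M)"
    proof (rule integral_mono)
      show "integrable M (\<lambda>w. indicator F w * - log 2 (?q F))"
        using integrable_indicator_real[OF QM[OF F]] by simp
      show "integrable M (\<lambda>w. indicator F w * - log 2 (pmf q (h w)))"
        by (rule integrable_mult_indicator_real(1)[OF QM[OF F] int])
      fix w assume w: "w \<in> space M"
      show "indicator F w * - log 2 (?q F) \<le> indicator F w * - log 2 (pmf q (h w))"
        using qpt[of w F] pos[OF w] by (auto simp: indicator_def)
    qed
    finally show "- prob F * log 2 (?q F) \<le> (\<integral>w. indicator F w * - log 2 (pmf q (h w)) \<partial>M)" .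
  qed
  also have "\<dots> = (\<integral>w. (\<Sum>F\<in>Q. indicator F w * - log 2 (pmf q (h w))) \<partial>M)"
    by (rule Bochner_Integration.integral_sum[symmetric]) (rule integrable_mult_indicator_real(1)[OF QM int])
  also have "\<dots> = (\<integral>w. - log 2 (pmf q (h w)) \<partial>M)"
  proof (rule Bochner_Integration.integral_cong)
    fix w assume w: "w \<in> space M"
    have "(\<Sum>F\<in>Q. indicator F w :: real) = indicator (\<Union>F\<in>Q. F) w"
      using dQ by (intro indicator_UN_disjoint[symmetric] finQ) (auto simp: disjoint_family_on_def disjoint_def)
    then have "(\<Sum>F\<in>Q. indicator F w :: real) = 1" using w QU by simp
    then show "(\<Sum>F\<in>Q. indicator F w * - log 2 (pmf q (h w))) = - log 2 (pmf q (h w))"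
      unfolding sum_distrib_right[symmetric] by simp
  qed simp
  finally show ?thesis .
qed

text \<open>Sets that do not separate \<open>v\<close> from \<open>w\<close> are closed under
  complements and countable unions, so only the generators matter.\<close>

lemma sig_gen_sets_saturated:
  assumes "\<And>j. j \<in> J \<Longrightarrow> a j v = a j w" "v \<in> space M" "w \<in> space M"
    and "E \<in> sigma_sets (space M) (\<Union>j\<in>J. gen_sets M N (a j))"
  shows "v \<in> E \<longleftrightarrow> w \<in> E"
  using assms(4) by induction (use assms(1-3) in \<open>auto simp: gen_sets_def\<close>)

text \<open>Data processing is built in: \<open>H\<close> lies inside the sigma-algebra of the
  codewords, so its events are unions of fibres of the word tuple \<open>h\<close>. Because the
  cross entropy is affine in each length, a bound on the summed mean lengths suffices, however they
  are distributed over the steps.\<close>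

lemma mutual_info_le_theta:
  fixes a :: "nat \<Rightarrow> 'a \<Rightarrow> bool list"
  assumes a: "\<And>k. a k \<in> measurable M cw" and L: "L > 0"
    and sub: "subalgebra M F" "subalgebra (sig M (\<Union>j<K. gen_sets M cw (a j))) H"
    and len: "(\<Sum>k<K. \<integral>\<^sup>+w. ennreal (real (length (a k w))) \<partial>M) \<le> ennreal (real K * L)"
  shows "mutual_info M (sets F) (sets H) \<le> ereal (real K * theta L)"
proof -
  let ?A = "\<Union>j<K. gen_sets M cw (a j)"
  have AM: "?A \<subseteq> events" using gen_sets_subset[OF a] by blast
  have HA: "sets H \<subseteq> sigma_sets (space M) ?A" using sub(2) by (simp add: subalgebra_def sets_sig[OF AM])
  have HM: "sets H \<subseteq> events" using HA sets.sigma_sets_subset[OF AM] by blast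
  define h where "h w = map (\<lambda>k. a k w) [0..<K]" for w
  define q where "q = replicate_pmf K (word_pmf L)"
  let ?c = "1 + log 2 (1 + L) - log 2 L"
  \<comment> \<open>The sign of the per-bit cost \<open>?c\<close> allows the upper bound on the
    lengths to be inserted.\<close>
  have c: "?c \<ge> 0"
  proof -
    have "log 2 L \<le> log 2 (1 + L)" using L by simp
    then show ?thesis by simp
  qed
  have qh: "pmf q (h w) = (\<Prod>k<K. pmf (word_pmf L) (a k w))" for w
    unfolding q_def by (subst pmf_replicate_pmf) (auto simp: h_def)
  have qpos: "pmf q (h w) > 0" for w unfolding qh by (intro prod_pos pmf_word_pmf_pos L ballI)
  have nlq: "- log 2 (pmf q (h w)) = (\<Sum>k<K. log 2 (1 + L) + real (length (a k w)) * ?c)" for w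
    unfolding qh neg_log_word_pmf[OF L, symmetric] using pmf_word_pmf_pos[OF L]
    by (subst log_def, subst ln_prod) (auto simp: sum_negf log_def sum_divide_distrib pmf_word_pmf_pos[OF L, THEN less_imp_neq, symmetric])
  have lenM: "(\<lambda>w. real (length (a k w))) \<in> borel_measurable M" for k
    using measurable_compose[OF a, of "\<lambda>l. real (length l)"] by simp
  have len_fin: "(\<integral>\<^sup>+w. ennreal (real (length (a k w))) \<partial>M) < \<infinity>" if "k < K" for k
  proof -
    have "(\<integral>\<^sup>+w. ennreal (real (length (a k w))) \<partial>M) \<le> (\<Sum>k<K. \<integral>\<^sup>+w. ennreal (real (length (a k w))) \<partial>M)"
      using that by (intro member_le_sum) auto
    also have "\<dots> < \<infinity>" using len by (rule le_less_trans) simp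
    finally show ?thesis .
  qed
  have ilen: "integrable M (\<lambda>w. real (length (a k w)))" if "k < K" for k
    using lenM len_fin[OF that] by (intro integrableI_bounded) auto
  have len': "(\<Sum>k<K. \<integral>w. real (length (a k w)) \<partial>M) \<le> real K * L"
  proof -
    have "ennreal (\<Sum>k<K. \<integral>w. real (length (a k w)) \<partial>M) = (\<Sum>k<K. ennreal (\<integral>w. real (length (a k w)) \<partial>M))"
      by (rule sum_ennreal[symmetric]) simp
    also have "\<dots> = (\<Sum>k<K. \<integral>\<^sup>+w. ennreal (real (length (a k w))) \<partial>M)"
      by (intro sum.cong refl nn_integral_eq_integral[symmetric] ilen) auto
    finally have "ennreal (\<Sum>k<K. \<integral>w. real (length (a k w)) \<partial>M) \<le> ennreal (real K * L)" using len by simp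
    then show ?thesis using L by (subst (asm) ennreal_le_iff) auto
  qed
  have int: "integrable M (\<lambda>w. - log 2 (pmf q (h w)))"
    unfolding nlq using ilen by (intro Bochner_Integration.integrable_sum) auto
  have bound: "(\<integral>w. - log 2 (pmf q (h w)) \<partial>M) \<le> real K * theta L"
  proof -
    have "(\<integral>w. - log 2 (pmf q (h w)) \<partial>M) = (\<Sum>k<K. log 2 (1 + L) + (\<integral>w. real (length (a k w)) \<partial>M) * ?c)"
      unfolding nlq using ilen by (subst Bochner_Integration.integral_sum) (auto simp: prob_space)
    also have "\<dots> = real K * log 2 (1 + L) + (\<Sum>k<K. \<integral>w. real (length (a k w)) \<partial>M) * ?c"
      by (simp only: sum.distrib sum_distrib_right) simp
    also have "\<dots> \<le> real K * log 2 (1 + L) + (real K * L) * ?c"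
      using len' c by (intro add_left_mono mult_right_mono) auto
    also have "\<dots> = real K * theta L"
      using L by (simp add: theta_pos_eq algebra_simps)
    finally show ?thesis .
  qed
  show ?thesis
    unfolding mutual_info_def
  proof (rule SUP_least)
    fix PQ assume "PQ \<in> {(P, Q). fin_part M (sets F) P \<and> fin_part M (sets H) Q}"
    then obtain P Q where PQ: "PQ = (P, Q)" "fin_part M (sets F) P" "fin_part M (sets H) Q" by auto
    have "(\<Sum>E\<in>P. \<Sum>F\<in>Q. (let p = prob (E \<inter> F) in if p = 0 then 0 else p * log 2 (p / (prob E * prob F))))
        \<le> (\<Sum>F\<in>Q. - prob F * log 2 (prob F))"
      using sub(1) by (intro partition_info_le_entropy[OF _ HM PQ(2,3)]) (simp add: subalgebra_def)
    also have "\<dots> \<le> (\<integral>w. - log 2 (pmf q (h w)) \<partial>M)"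
    proof (rule entropy_le_cross_entropy[OF HM PQ(3)])
      fix E w v assume E: "E \<in> sets H" "w \<in> E" "v \<in> space M" "h v = h w"
      then have "w \<in> space M" using HM sets.sets_into_space by blast
      moreover have "a j v = a j w" if "j \<in> {..<K}" for j
        using arg_cong[OF E(4), of "\<lambda>l. l ! j"] that by (simp add: h_def)
      ultimately show "v \<in> E" using sig_gen_sets_saturated[of "{..<K}" a v w E cw] E HA by blast
    qed (use qpos int in auto)
    also note bound
    finally show "ereal (\<Sum>E\<in>fst PQ. \<Sum>F\<in>snd PQ. (let p = prob (E \<inter> F) in if p = 0 then 0 else p * log 2 (p / (prob E * prob F))))
        \<le> ereal (real K * theta L)"
      by (simp add: PQ(1))
  qed
qed

end

section \<open>Gaussian moments\<close>

lemma borel_measurable_vec_iff: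
  fixes f :: "'a \<Rightarrow> real^'n"
  shows "f \<in> borel_measurable F \<longleftrightarrow> (\<forall>i. (\<lambda>w. f w $ i) \<in> borel_measurable F)"
  unfolding borel_measurable_euclidean_space[of f] by (auto simp: Basis_vec_def inner_axis)

lemma borel_measurable_vec_nth [measurable (raw)]:
  fixes f :: "'a \<Rightarrow> real^'n"
  shows "f \<in> borel_measurable F \<Longrightarrow> (\<lambda>w. f w $ i) \<in> borel_measurable F"
  by (simp add: borel_measurable_vec_iff)

text \<open>Moments come from bounds and limits rather than from differentiation under the integral:
  the mean from \<open>1 + u \<le> exp u\<close> with \<open>u = t * X\<close> and
  \<open>u = - t * X\<close> as \<open>t\<close> tends to 0, the variance from second differences of
  the moment generating function at 0.\<close>

lemma (in prob_space) centered_of_gaussian_mgf: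
  assumes X [measurable]: "X \<in> borel_measurable M"
    and mgf: "\<And>t. (\<integral>\<^sup>+w. ennreal (exp (t * X w)) \<partial>M) = ennreal (exp (t\<^sup>2 * s / 2))"
  shows "integrable M (\<lambda>w. (X w)\<^sup>2)" "integrable M X" "expectation X = 0" "expectation (\<lambda>w. (X w)\<^sup>2) = s"
proof -
  have iexp: "integrable M (\<lambda>w. exp (t * X w))" for t
    by (rule integrableI_bounded) (auto simp: mgf)
  have Eexp: "expectation (\<lambda>w. exp (t * X w)) = exp (t\<^sup>2 * s / 2)" for t
    using nn_integral_eq_integral[OF iexp, of t] mgf[of t] by simp
  have sq_le: "x\<^sup>2 \<le> 2 * exp \<bar>x\<bar>" for x :: real
    using exp_lower_Taylor_quadratic[of "\<bar>x\<bar>"] by simp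
  have exp_abs_le: "exp \<bar>x\<bar> \<le> exp x + exp (- x)" for x :: real
    by (auto simp: abs_if)
  show isq: "integrable M (\<lambda>w. (X w)\<^sup>2)"
  proof (rule Bochner_Integration.integrable_bound)
    show "integrable M (\<lambda>w. 2 * (exp (1 * X w) + exp (-1 * X w)))"
      using iexp by (intro Bochner_Integration.integrable_add integrable_mult_right)
    have "x\<^sup>2 \<le> 2 * (exp x + exp (- x))" for x :: real
      by (rule order_trans[OF sq_le mult_left_mono[OF exp_abs_le]]) simp
    then show "AE w in M. norm ((X w)\<^sup>2) \<le> norm (2 * (exp (1 * X w) + exp (-1 * X w)))"
      by (simp add: abs_of_nonneg add_nonneg_nonneg)
  qed simp
  show iX: "integrable M X"
  proof (rule Bochner_Integration.integrable_bound)
    show "integrable M (\<lambda>w. 1 + (X w)\<^sup>2)" using isq by simp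
    have "\<bar>x\<bar> \<le> 1 + x\<^sup>2" for x :: real
      using sum_power2_ge_zero[of "\<bar>x\<bar> - 1" 0] abs_ge_zero[of x] by (simp add: power2_eq_square algebra_simps)
    then show "AE w in M. norm (X w) \<le> norm (1 + (X w)\<^sup>2)" by simp
  qed simp
  have EX_le: "c * expectation X \<le> 0" if c: "\<bar>c\<bar> = 1" for c
  proof (rule tendsto_lowerbound)
    show "((\<lambda>t. (exp (t\<^sup>2 * s / 2) - 1) / t) \<longlongrightarrow> 0) (at_right 0)"
      by real_asymp
    have "c * expectation X \<le> (exp (t\<^sup>2 * s / 2) - 1) / t" if t: "t > 0" for t
    proof -
      have "1 + t * (c * expectation X) = expectation (\<lambda>w. 1 + (t * c) * X w)"
        using iX by (simp add: prob_space mult.assoc)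
      also have "\<dots> \<le> expectation (\<lambda>w. exp ((t * c) * X w))"
        using iX iexp[of "t * c"] by (intro integral_mono) auto
      also have "\<dots> = exp (t\<^sup>2 * s / 2)"
        using c by (auto simp: Eexp power_mult_distrib abs_square_eq_1 abs_if split: if_splits)
      finally show ?thesis using t by (simp add: field_simps)
    qed
    then show "\<forall>\<^sub>F t in at_right 0. c * expectation X \<le> (exp (t\<^sup>2 * s / 2) - 1) / t"
      by (auto simp: eventually_at_right_field intro!: exI[of _ 1])
  qed simp
  show "expectation X = 0" using EX_le[of 1] EX_le[of "-1"] by simp
  \<comment> \<open>The symmetric second difference quotient of
    \<open>\<lambda>t. exp (t * X w)\<close> at 0 with step \<open>1 / (n + 1)\<close>; it tends to
    \<open>(X w)\<^sup>2\<close>.\<close>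
  define g where "g n w = (exp (X w / real (Suc n)) + exp (- X w / real (Suc n)) - 2) * (real (Suc n))\<^sup>2" for n w
  have [measurable]: "g n \<in> borel_measurable M" for n unfolding g_def by measurable
  have Eg: "expectation (g n) = 2 * (exp ((1 / real (Suc n))\<^sup>2 * s / 2) - 1) * (real (Suc n))\<^sup>2" for n
  proof -
    let ?m = "real (Suc n)"
    have i: "integrable M (\<lambda>w. exp (X w / ?m))" "integrable M (\<lambda>w. exp (- X w / ?m))"
      using iexp[of "1 / ?m"] iexp[of "- 1 / ?m"] by simp_all
    have "expectation (\<lambda>w. exp (X w / ?m)) = exp ((1 / ?m)\<^sup>2 * s / 2)"
      "expectation (\<lambda>w. exp (- X w / ?m)) = exp ((1 / ?m)\<^sup>2 * s / 2)"
      using Eexp[of "1 / ?m"] Eexp[of "- 1 / ?m"] by simp_all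
    then show ?thesis
      unfolding g_def using i by (simp only: prob_space integral_mult_left_zero Bochner_Integration.integral_add
        Bochner_Integration.integral_diff integrable_const Bochner_Integration.integrable_add) (simp add: prob_space)
  qed
  have "(\<lambda>n. expectation (g n)) \<longlonglongrightarrow> expectation (\<lambda>w. (X w)\<^sup>2)"
  proof (rule integral_dominated_convergence[where w="\<lambda>w. 2 * (exp (2 * X w) + exp (- 2 * X w))"])
    show "integrable M (\<lambda>w. 2 * (exp (2 * X w) + exp (- 2 * X w)))"
      using iexp by (intro Bochner_Integration.integrable_add integrable_mult_right)
    have "(\<lambda>n. (exp (x / real (Suc n)) + exp (- x / real (Suc n)) - 2) * (real (Suc n))\<^sup>2) \<longlonglongrightarrow> x * x" for x :: real
      by real_asymp
    then show "AE w in M. (\<lambda>n. g n w) \<longlonglongrightarrow> (X w)\<^sup>2"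
      unfolding g_def power2_eq_square[of "X _"] by (intro AE_I2)
    show "AE w in M. norm (g n w) \<le> 2 * (exp (2 * X w) + exp (- 2 * X w))" for n
    proof (rule AE_I2)
      fix w
      define x m where "x = X w" and "m = real (Suc n)"
      \<comment> \<open>With this substitution \<open>g n w\<close> is
        \<open>(exp z - exp (- z))\<^sup>2 * m\<^sup>2\<close>, and
        \<open>exp z - exp (- z) \<le> 2 * z * exp z\<close> absorbs the growing factor
        \<open>m\<close>, so the dominating function does not depend on \<open>n\<close>.\<close>
      define z where "z = \<bar>x\<bar> / (2 * m)"
      have m: "m \<ge> 1" and z: "z \<ge> 0" by (simp_all add: m_def z_def)
      have zm: "2 * z * m = \<bar>x\<bar>" using m by (simp add: z_def)
      have "exp (x / m) + exp (- x / m) = exp (2 * z) + exp (- (2 * z))"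
        using m by (cases "x \<ge> 0") (auto simp: z_def)
      moreover have "exp (2 * z) + exp (- (2 * z)) - 2 = (exp z - exp (- z))\<^sup>2"
      proof -
        have "exp z * exp (- z) = 1" by (simp add: mult_exp_exp)
        then show ?thesis
          using exp_double[of z] exp_double[of "- z"] by (simp add: power2_diff mult.assoc)
      qed
      ultimately have gz: "g n w = (exp z - exp (- z))\<^sup>2 * m\<^sup>2"
        by (simp only: g_def x_def m_def)
      have "exp z - exp (- z) = exp z * (1 - exp (- 2 * z))"
        by (simp add: right_diff_distrib mult_exp_exp)
      also have "\<dots> \<le> exp z * (2 * z)"
        using exp_ge_add_one_self[of "- 2 * z"] by (intro mult_left_mono) auto
      finally have "(exp z - exp (- z))\<^sup>2 \<le> (exp z * (2 * z))\<^sup>2"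
        using z by (intro power_mono) auto
      then have "g n w \<le> (exp z * (2 * z))\<^sup>2 * m\<^sup>2"
        unfolding gz by (intro mult_right_mono) auto
      also have "\<dots> = (2 * z * m)\<^sup>2 * (exp z)\<^sup>2"
        by (simp add: power_mult_distrib)
      also have "\<dots> = x\<^sup>2 * exp (2 * z)"
        by (simp add: zm exp_double)
      also have "\<dots> \<le> (2 * exp \<bar>x\<bar>) * exp \<bar>x\<bar>"
      proof (intro mult_mono sq_le)
        have "\<bar>x\<bar> / m \<le> \<bar>x\<bar> / 1" using m by (intro divide_left_mono) auto
        then show "exp (2 * z) \<le> exp \<bar>x\<bar>" by (simp add: z_def)
      qed auto
      also have "\<dots> = 2 * exp \<bar>2 * x\<bar>" by (simp add: exp_add[symmetric] abs_mult)
      also have "\<dots> \<le> 2 * (exp (2 * x) + exp (- 2 * x))" using exp_abs_le[of "2 * x"] by simp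
      finally show "norm (g n w) \<le> 2 * (exp (2 * X w) + exp (- 2 * X w))"
        by (simp add: x_def gz)
    qed
  qed simp_all
  moreover have "(\<lambda>n. expectation (g n)) \<longlonglongrightarrow> s"
    unfolding Eg by real_asymp
  ultimately show "expectation (\<lambda>w. (X w)\<^sup>2) = s" by (rule LIMSEQ_unique)
qed

section \<open>Gaussian densities\<close>

lemma pos_def_invertible:
  assumes "pos_def S"
  shows "S ** matrix_inv S = mat 1" "matrix_inv S ** S = mat 1"
proof -
  have "\<exists>B. B ** S = mat 1"
    unfolding matrix_left_invertible_ker using assms by (metis inner_zero_right less_irrefl pos_def_def)
  then have "\<exists>B. S ** B = mat 1 \<and> B ** S = mat 1"
    by (metis matrix_left_right_inverse)
  then have "S ** matrix_inv S = mat 1 \<and> matrix_inv S ** S = mat 1"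
    unfolding matrix_inv_def by (rule someI_ex)
  then show "S ** matrix_inv S = mat 1" "matrix_inv S ** S = mat 1" by auto
qed

lemma inner_matrix_transpose: "(x::real^'n) \<bullet> (A *v y) = (transpose A *v x) \<bullet> (y::real^'m)"
  by (simp add: dot_lmul_matrix)

lemma gauss_pdf_measurable [measurable]: "gauss_pdf S \<in> borel_measurable borel"
  unfolding gauss_pdf_def
  by (intro borel_measurable_divide borel_measurable_continuous_onI continuous_intros
      bounded_linear.continuous_on[OF matrix_vector_mul_bounded_linear]) auto

lemma sets_gauss [simp, measurable_cong]: "sets (gauss S) = sets borel"
  by (simp add: gauss_def)

text \<open>\<open>matrix_inv S\<close> maps \<open>S *v axis j 1\<close> to
  \<open>axis j 1\<close>, so the cross term of the quadratic form reduces to the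
  \<open>j\<close>-th coordinate.\<close>

lemma gauss_pdf_shift:
  assumes "pos_def S"
  shows "gauss_pdf S (v + h *\<^sub>R (S *v axis j 1)) = gauss_pdf S v * exp (- h * v $ j - h\<^sup>2 * S $ j $ j / 2)"
proof -
  let ?P = "matrix_inv S" and ?u = "S *v axis j 1"
  have sym: "transpose S = S" using assms by (simp add: pos_def_def)
  have Pu: "?P *v ?u = axis j 1"
    by (simp add: matrix_vector_mul_assoc pos_def_invertible[OF assms])
  have uP: "?u \<bullet> (?P *v w) = w $ j" for w
  proof -
    have "?u \<bullet> (?P *v w) = axis j 1 \<bullet> (S *v (?P *v w))"
      by (subst inner_matrix_transpose) (simp add: sym)
    then show ?thesis by (simp add: matrix_vector_mul_assoc pos_def_invertible[OF assms] inner_axis')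
  qed
  have Sjj: "?u $ j = S $ j $ j" by (simp add: matrix_vector_mult_def axis_def if_distrib cong: if_cong)
  have "(v + h *\<^sub>R ?u) \<bullet> (?P *v (v + h *\<^sub>R ?u)) = v \<bullet> (?P *v v) + 2 * h * v $ j + h\<^sup>2 * S $ j $ j"
    by (simp add: matrix_vector_right_distrib matrix_vector_mult_scaleR inner_add_left inner_add_right Pu uP Sjj inner_axis
        power2_eq_square algebra_simps)
  then have "- ((v + h *\<^sub>R ?u) \<bullet> (?P *v (v + h *\<^sub>R ?u))) / 2
      = - (v \<bullet> (?P *v v)) / 2 + (- h * v $ j - h\<^sup>2 * S $ j $ j / 2)"
    by (simp add: field_simps)
  then show ?thesis unfolding gauss_pdf_def by (simp only: exp_add) simp
qed

text \<open>Translating the density along \<open>S *v axis j 1\<close> multiplies it by an exponential in the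
  \<open>j\<close>-th coordinate alone, so translation invariance of Lebesgue measure yields the
  moment generating function without diagonalising \<open>S\<close>.\<close>

lemma gauss_mgf:
  fixes S :: "real^'n^'n"
  assumes S: "pos_def S" and prob: "prob_space (gauss S)"
  shows "(\<integral>\<^sup>+v. ennreal (exp (t * v $ j)) \<partial>gauss S) = ennreal (exp (t\<^sup>2 * S $ j $ j / 2))"
proof -
  let ?u = "S *v axis j 1"
  \<comment> \<open>Normalisation is read off from \<open>prob\<close>, which holds as soon as the
    density is the law of a random vector; the Gaussian integral itself is never evaluated.\<close>
  have one: "(\<integral>\<^sup>+v. ennreal (gauss_pdf S v) \<partial>lborel) = 1"
    using prob_space.emeasure_space_1[OF prob]
    by (simp add: gauss_def emeasure_density space_density)
  have "(\<integral>\<^sup>+v. ennreal (exp (t * v $ j)) \<partial>gauss S) = (\<integral>\<^sup>+v. ennreal (gauss_pdf S v) * ennreal (exp (t * v $ j)) \<partial>lborel)"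
    unfolding gauss_def by (subst nn_integral_density) auto
  also have "\<dots> = (\<integral>\<^sup>+v. ennreal (exp (t\<^sup>2 * S $ j $ j / 2)) * ennreal (gauss_pdf S ((- t) *\<^sub>R ?u + v)) \<partial>lborel)"
  proof (intro nn_integral_cong)
    fix v :: "real^'n"
    have "gauss_pdf S v * exp (t * v $ j) = exp (t\<^sup>2 * S $ j $ j / 2) * gauss_pdf S (v + (- t) *\<^sub>R ?u)"
      unfolding gauss_pdf_shift[OF S] by (simp add: exp_diff)
    then show "ennreal (gauss_pdf S v) * ennreal (exp (t * v $ j))
        = ennreal (exp (t\<^sup>2 * S $ j $ j / 2)) * ennreal (gauss_pdf S ((- t) *\<^sub>R ?u + v))"
      by (metis add.commute ennreal_mult' ennreal_mult'' exp_ge_zero)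
  qed
  also have "\<dots> = ennreal (exp (t\<^sup>2 * S $ j $ j / 2)) * (\<integral>\<^sup>+v. ennreal (gauss_pdf S ((- t) *\<^sub>R ?u + v)) \<partial>lborel)"
    by (rule nn_integral_cmult) measurable
  also have "(\<integral>\<^sup>+v. ennreal (gauss_pdf S ((- t) *\<^sub>R ?u + v)) \<partial>lborel)
      = (\<integral>\<^sup>+v. ennreal (gauss_pdf S v) \<partial>distr lborel borel ((+) ((- t) *\<^sub>R ?u)))"
    by (subst nn_integral_distr) auto
  also have "\<dots> = 1" unfolding lborel_distr_plus by (rule one)
  finally show ?thesis by simp
qed

lemma (in prob_space) gauss_moments:
  fixes X :: "'a \<Rightarrow> real^'n"
  assumes S: "pos_def S" and X [measurable]: "X \<in> borel_measurable M" and d: "distr M borel X = gauss S"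
  shows "integrable M (\<lambda>w. (X w $ j)\<^sup>2)" "expectation (\<lambda>w. X w $ j) = 0"
    "expectation (\<lambda>w. (X w $ j)\<^sup>2) = S $ j $ j"
proof -
  have "prob_space (gauss S)" unfolding d[symmetric] by (rule prob_space_distr) (rule X)
  then have mgf: "(\<integral>\<^sup>+w. ennreal (exp (t * X w $ j)) \<partial>M) = ennreal (exp (t\<^sup>2 * S $ j $ j / 2))" for t
  proof -
    have "(\<integral>\<^sup>+w. ennreal (exp (t * X w $ j)) \<partial>M) = (\<integral>\<^sup>+v. ennreal (exp (t * v $ j)) \<partial>distr M borel X)"
      by (rule nn_integral_distr[symmetric]) auto
    then show ?thesis using gauss_mgf[OF S \<open>prob_space (gauss S)\<close>] by (simp add: d)
  qed
  have "(\<lambda>w. X w $ j) \<in> borel_measurable M" by measurable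
  from centered_of_gaussian_mgf[OF this mgf]
  show "integrable M (\<lambda>w. (X w $ j)\<^sup>2)" "expectation (\<lambda>w. X w $ j) = 0"
    "expectation (\<lambda>w. (X w $ j)\<^sup>2) = S $ j $ j"
    by auto
qed

section \<open>The rate-distortion lower bound\<close>

lemma borel_measurable_vcond_exp: "vcond_exp M F X \<in> borel_measurable F"
  unfolding borel_measurable_vec_iff by (simp add: vcond_exp_def)

text \<open>Places the rate in the range where \<open>theta_inv\<close> is a genuine inverse, as
  \<open>theta_inv_e_le\<close> requires.\<close>

lemma R_DT_nonneg: "0 \<le> R_DT A B S0 D Q \<tau>"
  unfolding R_DT_def
proof (rule INF_greatest, clarify)
  fix M x xh
  assume dt: "dt_source M A B S0 \<tau> x"
    and ck: "causal_kernel M (borel :: (real^'a) measure) (\<Union>j. gen_sets M borel (x j)) (\<lambda>k. \<Union>j\<le>k. gen_sets M borel (x j)) xh"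
  interpret prob_space M using dt by (simp add: dt_source_def)
  have "gen_sets M borel (x j) \<subseteq> sets M" "gen_sets M borel (xh j) \<subseteq> sets M" for j
    using dt ck by (auto intro!: gen_sets_subset simp: dt_source_def causal_kernel_def)
  then have "0 \<le> mutual_info M (sets (sig M (\<Union>j<K. gen_sets M borel (x j)))) (sets (sig M (\<Union>j<K. gen_sets M borel (xh j))))" for K
    by (intro mutual_info_nonneg subalgebra_sig) blast+
  then show "0 \<le> limsup (\<lambda>K. ereal (1 / real K) * mutual_info M (sets (sig M (\<Union>j<K. gen_sets M borel (x j))))
      (sets (sig M (\<Union>j<K. gen_sets M borel (xh j)))))"
    by (intro le_Limsup always_eventually) auto
qed

lemma L_DT_ge_theta_inv:
  fixes A B S0 Q :: "real^'n^'n"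
  assumes \<tau>: "\<tau> > 0"
  shows "L_DT A B S0 D Q \<tau> \<ge> ereal (1 / \<tau>) * theta_inv_e (R_DT A B S0 D Q \<tau>)"
  unfolding L_DT_def
proof (rule INF_greatest, clarify)
  fix M :: "real measure" and x :: "nat \<Rightarrow> real \<Rightarrow> real^'n" and a :: "nat \<Rightarrow> real \<Rightarrow> bool list"
  let ?Src = "\<Union>j. gen_sets M borel (x j)" and ?past = "\<lambda>k. \<Union>j\<le>k. gen_sets M borel (x j)"
  let ?A = "\<lambda>k. sig M (\<Union>j\<le>k. gen_sets M cw (a j))"
  define xh where "xh k = vcond_exp M (?A k) (x k)" for k
  let ?R = "R_DT A B S0 D Q \<tau>"
  assume dt: "dt_source M A B S0 \<tau> x" and ck: "causal_kernel M cw ?Src ?past a"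
    and dist: "limsup (\<lambda>K. ennreal (1 / real K) * (\<Sum>k<K. \<integral>\<^sup>+ w. ennreal (qnorm2 Q (x k w - vcond_exp M (?A k) (x k) w)) \<partial>M)) \<le> ennreal D"
  interpret prob_space M using dt by (simp add: dt_source_def)
  have a: "a k \<in> measurable M cw" for k using ck by (simp add: causal_kernel_def)
  have gx: "gen_sets M borel (x j) \<subseteq> sets M" for j
    using dt by (intro gen_sets_subset) (simp add: dt_source_def)
  have ga: "gen_sets M cw (a j) \<subseteq> sets M" for j by (rule gen_sets_subset[OF a])
  have pM: "?past k \<subseteq> sets M" for k using gx by blast
  have pS: "?past k \<subseteq> ?Src" for k by blast
  have SM: "?Src \<subseteq> sets M" using gx by blast
  have aM: "(\<Union>j\<in>J. gen_sets M cw (a j)) \<subseteq> sets M" for J using ga by blast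
  have YM: "?past k \<union> (\<Union>j\<le>k. gen_sets M cw (a j)) \<subseteq> sets M" for k using pM aM by blast
  have pmono: "mono ?past" by (intro monoI UN_mono) auto
  have xhF: "xh j \<in> borel_measurable F" if "(\<Union>i\<le>j. gen_sets M cw (a i)) \<subseteq> sets F" "space F = space M" for F j
    unfolding xh_def
    by (rule measurable_from_subalg[OF subalgebra_sig_least[OF aM that] borel_measurable_vcond_exp])
  \<comment> \<open>The history of \<open>xh\<close> may be coarser than that of the codewords, so
    the kernel property is rebuilt from conditional independence, with the samples and codewords up
    to \<open>k\<close> as ambient sigma-algebra.\<close>
  have ckh: "causal_kernel M borel ?Src ?past xh"
  proof (rule causal_kernel_of_cond_indep[OF pM pS SM])
    let ?Y = "\<lambda>k. sig M (?past k \<union> (\<Union>j\<le>k. gen_sets M cw (a j)))"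
    show "subalgebra M (?Y k)" for k by (rule subalgebra_sig[OF YM])
    show "?past k \<subseteq> sets (?Y k)" for k using sig_superset[OF YM] by blast
    show "xh j \<in> borel_measurable (?Y k)" if "j \<le> k" for j k
    proof (rule xhF)
      have "(\<Union>i\<le>j. gen_sets M cw (a i)) \<subseteq> (\<Union>i\<le>k. gen_sets M cw (a i))" using that by (intro UN_mono) auto
      then show "(\<Union>i\<le>j. gen_sets M cw (a i)) \<subseteq> sets (?Y k)" using sig_superset[OF YM[of k]] by blast
    qed simp
    show "cond_indep (sig M (?past k)) (sig M ?Src) (?Y k)" for k
      by (rule causal_kernel_cond_indep[OF pM pS pmono SM ck])
  qed
  let ?mi = "\<lambda>K. mutual_info M (sets (sig M (\<Union>j<K. gen_sets M borel (x j)))) (sets (sig M (\<Union>j<K. gen_sets M borel (xh j))))"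
  have R: "?R \<le> limsup (\<lambda>K. ereal (1 / real K) * ?mi K)"
    unfolding R_DT_def using dt ckh dist by (intro INF_lower2[where i="(M, x, xh)"]) (auto simp: xh_def)
  show "ereal (1 / \<tau>) * theta_inv_e ?R \<le> enn2ereal (ct_rate M \<tau> a)"
  \<comment> \<open>A level strictly above the rate serves twice: the length bound then holds for
    every large \<open>K\<close> at a fixed \<open>L\<close>, and \<open>L\<close> is positive even
    at rate zero, as the geometric reference distribution requires.\<close>
  proof (rule dense_ge)
    fix z assume z: "enn2ereal (ct_rate M \<tau> a) < z"
    show "ereal (1 / \<tau>) * theta_inv_e ?R \<le> z"
    proof (cases z)
      case (real l)
      have l0: "l > 0" using z real enn2ereal_nonneg[of "ct_rate M \<tau> a"] by (cases "enn2ereal (ct_rate M \<tau> a)") auto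
      define L where "L = l * \<tau>"
      have L: "L > 0" using l0 \<tau> by (simp add: L_def)
      have "ct_rate M \<tau> a < ennreal l"
        using z l0 unfolding real less_ennreal.rep_eq by (simp add: ennreal.rep_eq max_def)
      then have "eventually (\<lambda>K. ennreal (1 / (real K * \<tau>)) * (\<Sum>k<K. \<integral>\<^sup>+ w. ennreal (real (length (a k w))) \<partial>M) < ennreal l) sequentially"
        unfolding ct_rate_def by (rule Limsup_lessD)
      then have "eventually (\<lambda>K. ereal (1 / real K) * ?mi K \<le> ereal (theta L)) sequentially"
        using eventually_gt_at_top[of 0]
      proof eventually_elim
        case (elim K)
        let ?S = "\<Sum>k<K. \<integral>\<^sup>+ w. ennreal (real (length (a k w))) \<partial>M"
        have "?S = ennreal (real K * \<tau> * (1 / (real K * \<tau>))) * ?S" using elim(2) \<tau> by simp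
        also have "\<dots> = ennreal (real K * \<tau>) * (ennreal (1 / (real K * \<tau>)) * ?S)"
          using elim(2) \<tau> by (subst ennreal_mult) (auto simp: mult.assoc)
        also have "\<dots> \<le> ennreal (real K * \<tau>) * ennreal l"
          using elim(1) by (intro mult_left_mono) auto
        also have "\<dots> = ennreal (real K * L)"
          using \<tau> l0 by (simp add: ennreal_mult[symmetric] L_def mult_ac)
        finally have "?mi K \<le> ereal (real K * theta L)"
        proof (intro mutual_info_le_theta[OF a L])
          show "subalgebra M (sig M (\<Union>j<K. gen_sets M borel (x j)))"
            using gx by (intro subalgebra_sig) blast
          \<comment> \<open>\<open>xh j\<close> uses only the codewords up to \<open>j\<close>, so
            the first \<open>K\<close> reconstructions are functions of the first \<open>K\<close>
            codewords.\<close>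
          show "subalgebra (sig M (\<Union>j<K. gen_sets M cw (a j))) (sig M (\<Union>j<K. gen_sets M borel (xh j)))"
          proof (rule subalgebra_sig_least)
            have xM: "xh j \<in> borel_measurable M" for j using aM by (intro xhF) auto
            show "(\<Union>j<K. gen_sets M borel (xh j)) \<subseteq> sets M" using gen_sets_subset[OF xM] by blast
            show "(\<Union>j<K. gen_sets M borel (xh j)) \<subseteq> sets (sig M (\<Union>j<K. gen_sets M cw (a j)))"
            proof (rule UN_least)
              fix j assume j: "j \<in> {..<K}"
              then have "(\<Union>i\<le>j. gen_sets M cw (a i)) \<subseteq> (\<Union>i<K. gen_sets M cw (a i))" by (intro UN_mono) auto
              then show "gen_sets M borel (xh j) \<subseteq> sets (sig M (\<Union>j<K. gen_sets M cw (a j)))"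
                using sig_superset[OF aM[of "{..<K}"]] by (intro gen_sets_subset_subalgebra xhF) auto
            qed
          qed simp
        qed auto
        then have "ereal (1 / real K) * ?mi K \<le> ereal (1 / real K) * ereal (real K * theta L)"
          by (intro ereal_mult_left_mono) auto
        then show ?case using elim(2) by simp
      qed
      then have "limsup (\<lambda>K. ereal (1 / real K) * ?mi K) \<le> ereal (theta L)"
        by (rule Limsup_bounded)
      with R have "?R \<le> ereal (theta L)" by simp
      then have "theta_inv_e ?R \<le> ereal L"
        using L by (intro theta_inv_e_le R_DT_nonneg) auto
      then have "ereal (1 / \<tau>) * theta_inv_e ?R \<le> ereal (1 / \<tau>) * ereal L"
        using \<tau> by (intro ereal_mult_left_mono) auto
      then show ?thesis using \<tau> by (simp add: L_def real)
    qed (use z in auto)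
  qed
qed

section \<open>The matrix exponential and the discretisation matrices\<close>

lemma mat_pow_commute: "mat_pow M k ** M = M ** mat_pow M k"
  by (induction k) (simp_all add: matrix_mul_assoc[symmetric])

lemma mat_pow_scaleR: "mat_pow (s *\<^sub>R M) k = s ^ k *\<^sub>R mat_pow M k"
  by (induction k) (simp_all add: matrix_matrix_mult_def vec_eq_iff sum_distrib_left mult_ac)

lemma mat_pow_transpose: "mat_pow (transpose M) k = transpose (mat_pow M k)"
  by (induction k) (simp_all add: matrix_transpose_mul[symmetric] mat_pow_commute)

text \<open>The sum of all absolute entries dominates every absolute row sum, so one more factor
  \<open>M\<close> multiplies the entry bound by at most \<open>c\<close>.\<close>

lemma mat_pow_entry_bound:
  fixes M :: "real^'n^'n"
  defines "c \<equiv> (\<Sum>i\<in>UNIV. \<Sum>j\<in>UNIV. \<bar>M $ i $ j\<bar>)"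
  shows "\<bar>mat_pow M k $ i $ j\<bar> \<le> c ^ k"
proof (induction k arbitrary: i j)
  case 0
  then show ?case by (simp add: mat_def)
next
  case (Suc k)
  have c: "0 \<le> c" by (simp add: c_def sum_nonneg)
  have "\<bar>mat_pow M (Suc k) $ i $ j\<bar> \<le> (\<Sum>l\<in>UNIV. \<bar>M $ i $ l\<bar> * c ^ k)"
    by (simp add: matrix_matrix_mult_def) (intro order_trans[OF sum_abs] sum_mono, simp add: abs_mult mult_left_mono Suc)
  also have "\<dots> = (\<Sum>l\<in>UNIV. \<bar>M $ i $ l\<bar>) * c ^ k" by (simp add: sum_distrib_right)
  also have "\<dots> \<le> c * c ^ k"
    using c unfolding c_def
    by (intro mult_right_mono member_le_sum[of i UNIV "\<lambda>i. \<Sum>j\<in>UNIV. \<bar>M $ i $ j\<bar>"]) (auto simp: sum_nonneg)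
  finally show ?case by simp
qed

lemma summable_mexp_entry:
  fixes M :: "real^'n^'n"
  shows "summable (\<lambda>k. mat_pow M k $ i $ j / fact k * y ^ k)"
proof -
  define c where "c = (\<Sum>i\<in>UNIV. \<Sum>j\<in>UNIV. \<bar>M $ i $ j\<bar>)"
  have "summable (\<lambda>k. inverse (fact k) * (c * \<bar>y\<bar>) ^ k)"
    by (rule summable_exp)
  then show ?thesis
  proof (rule summable_comparison_test'[where N=0])
    fix k :: nat
    have "\<bar>mat_pow M k $ i $ j\<bar> * \<bar>y\<bar> ^ k \<le> c ^ k * \<bar>y\<bar> ^ k"
      using mat_pow_entry_bound[of M k i j] by (intro mult_right_mono) (auto simp: c_def)
    then show "norm (mat_pow M k $ i $ j / fact k * y ^ k) \<le> inverse (fact k) * (c * \<bar>y\<bar>) ^ k"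
      by (simp add: abs_mult power_abs power_mult_distrib divide_simps)
  qed
qed

text \<open>Each entry is a scalar power series in \<open>s\<close> that converges everywhere;
  continuity, transposition and the value at 0 are read off from it.\<close>

lemma mexp_entry: "mexp (s *\<^sub>R M) $ i $ j = (\<Sum>k. mat_pow M k $ i $ j / fact k * s ^ k)"
proof -
  have "(\<lambda>k. (1 / fact k) *\<^sub>R mat_pow (s *\<^sub>R M) k) sums (\<chi> i j. \<Sum>k. mat_pow M k $ i $ j / fact k * s ^ k)"
    unfolding sums_def
  proof (intro vec_tendstoI)
    fix i j
    have "(\<lambda>k. mat_pow M k $ i $ j / fact k * s ^ k) sums (\<Sum>k. mat_pow M k $ i $ j / fact k * s ^ k)"
      by (rule summable_sums[OF summable_mexp_entry])
    then show "(\<lambda>n. (\<Sum>k<n. (1 / fact k) *\<^sub>R mat_pow (s *\<^sub>R M) k) $ i $ j)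
        \<longlonglongrightarrow> (\<chi> i j. \<Sum>k. mat_pow M k $ i $ j / fact k * s ^ k) $ i $ j"
      by (simp add: sums_def mat_pow_scaleR mult.commute)
  qed
  then show ?thesis
    unfolding mexp_def by (simp add: sums_iff)
qed

lemma continuous_on_matrix_iff:
  fixes f :: "'a::topological_space \<Rightarrow> real^'n^'m"
  shows "continuous_on S f \<longleftrightarrow> (\<forall>i j. continuous_on S (\<lambda>x. f x $ i $ j))"
proof
  assume *: "\<forall>i j. continuous_on S (\<lambda>x. f x $ i $ j)"
  have "continuous_on S (\<lambda>x. \<chi> i j. f x $ i $ j)" by (intro continuous_on_vec_lambda) (use * in auto)
  then show "continuous_on S f" by simp
qed (auto intro: continuous_on_component)

lemma continuous_on_matrix_mult [continuous_intros]:
  fixes f :: "'a::topological_space \<Rightarrow> real^'n^'m" and g :: "'a \<Rightarrow> real^'k^'n"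
  assumes "continuous_on S f" "continuous_on S g"
  shows "continuous_on S (\<lambda>x. f x ** g x)"
  using assms unfolding continuous_on_matrix_iff
  by (simp add: matrix_matrix_mult_def continuous_on_sum continuous_on_mult)

lemma continuous_on_transpose [continuous_intros]:
  fixes f :: "'a::topological_space \<Rightarrow> real^'n^'m"
  assumes "continuous_on S f"
  shows "continuous_on S (\<lambda>x. transpose (f x))"
  using assms unfolding continuous_on_matrix_iff by (auto simp: transpose_def)

lemma continuous_on_mexp_scaleR [continuous_intros]: "continuous_on S (\<lambda>s. mexp (s *\<^sub>R M))"
  unfolding continuous_on_matrix_iff mexp_entry
  by (intro allI continuous_at_imp_continuous_on ballI isCont_powser_converges_everywhere summable_mexp_entry)

lemma continuous_on_A_s [continuous_intros]: "continuous_on S (A_s A)"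
  using continuous_on_mexp_scaleR[of S A] by (simp add: A_s_def[abs_def])

lemma mexp_transpose: "mexp (s *\<^sub>R transpose M) = transpose (mexp (s *\<^sub>R M))"
  by (simp add: vec_eq_iff mexp_entry mat_pow_transpose) (simp add: transpose_def mexp_entry)

lemma A_s_0 [simp]: "A_s A 0 = mat 1"
proof -
  have "(\<lambda>k. mat_pow A k $ i $ j / fact k * 0 ^ k) sums (mat_pow A 0 $ i $ j / fact 0 * 1)" for i j
    using sums_If_finite_set[of "{0}" "\<lambda>k. mat_pow A k $ i $ j / fact k"]
    by (simp add: power_0_left if_distrib cong: if_cong)
  then show ?thesis unfolding vec_eq_iff A_s_def mexp_entry by (simp add: sums_iff)
qed

lemma integral_matrix_entry:
  fixes f :: "real \<Rightarrow> real^'n^'m"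
  assumes "f integrable_on S"
  shows "integral S f $ i $ j = integral S (\<lambda>x. f x $ i $ j)" "(\<lambda>x. f x $ i $ j) integrable_on S"
proof -
  have "bounded_linear (\<lambda>M::real^'n^'m. M $ i $ j)"
    by (rule bounded_linear_compose[OF bounded_linear_vec_nth bounded_linear_vec_nth])
  then show "integral S f $ i $ j = integral S (\<lambda>x. f x $ i $ j)" "(\<lambda>x. f x $ i $ j) integrable_on S"
    using integral_linear[OF assms] integrable_linear[OF assms] by (force simp: o_def)+
qed

lemma quadratic_form_entries: "(v::real^'n) \<bullet> (M *v v) = (\<Sum>i\<in>UNIV. \<Sum>j\<in>UNIV. M $ i $ j * (v $ i * v $ j))"
  by (simp add: inner_vec_def matrix_vector_mult_def sum_distrib_left mult_ac)

lemma integral_quadratic_form: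
  fixes f :: "real \<Rightarrow> real^'n^'n"
  assumes "f integrable_on S"
  shows "v \<bullet> (integral S f *v v) = integral S (\<lambda>x. v \<bullet> (f x *v v))"
  using integral_matrix_entry[OF assms]
  by (simp add: quadratic_form_entries integral_sum integrable_sum integrable_on_mult_left)

section \<open>Noise covariance and weight matrix over a period\<close>

definition BBt_integrand :: "real^'n^'n \<Rightarrow> real^'n^'n \<Rightarrow> real \<Rightarrow> real^'n^'n" where
  "BBt_integrand A B l = A_s A l ** (B ** transpose B) ** transpose (A_s A l)"

lemma BBt_s_eq: "BBt_s A B s = integral {0..s} (BBt_integrand A B)"
  by (simp add: BBt_s_def BBt_integrand_def[abs_def])

lemma continuous_on_BBt_integrand: "continuous_on S (BBt_integrand A B)"
  unfolding BBt_integrand_def[abs_def] by (intro continuous_intros)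

lemma BBt_integrand_integrable: "BBt_integrand A B integrable_on {a..b}"
  by (rule integrable_continuous_interval[OF continuous_on_BBt_integrand])

lemma continuous_on_BBt_s: "continuous_on {0..t} (BBt_s A B)"
  unfolding BBt_s_eq[abs_def] by (rule indefinite_integral_continuous_1[OF BBt_integrand_integrable])

lemma BBt_integrand_form:
  "v \<bullet> (BBt_integrand A B l *v v) = (v v* A_s A l) \<bullet> ((B ** transpose B) *v (v v* A_s A l))"
proof -
  have "v \<bullet> (BBt_integrand A B l *v v) = v \<bullet> (A_s A l *v ((B ** transpose B) *v (transpose (A_s A l) *v v)))"
    by (simp only: BBt_integrand_def matrix_vector_mul_assoc matrix_mul_assoc)
  also have "\<dots> = (transpose (A_s A l) *v v) \<bullet> ((B ** transpose B) *v (transpose (A_s A l) *v v))"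
    by (rule inner_matrix_transpose)
  finally show ?thesis by simp
qed

lemma pos_def_nonneg: "pos_def S \<Longrightarrow> 0 \<le> v \<bullet> (S *v v)"
  by (cases "v = 0") (auto simp: pos_def_def less_imp_le)

text \<open>Ensures that the increments are nondegenerate, so that \<open>gauss_moments\<close>
  gives their mean and variance.\<close>

lemma pos_def_BBt_s:
  fixes A B :: "real^'n^'n"
  assumes B: "pos_def (B ** transpose B)" and s: "s > 0"
  shows "pos_def (BBt_s A B s)"
  unfolding pos_def_def
proof (intro conjI allI impI)
  have "transpose (BBt_integrand A B l) = BBt_integrand A B l" for l
    by (simp add: BBt_integrand_def matrix_transpose_mul matrix_mul_assoc)
  then have "BBt_integrand A B l $ j $ i = BBt_integrand A B l $ i $ j" for i j l
    by (metis (no_types) transpose_def vec_lambda_beta)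
  then show "transpose (BBt_s A B s) = BBt_s A B s"
    by (simp add: transpose_def BBt_s_eq vec_eq_iff integral_matrix_entry[OF BBt_integrand_integrable])
next
  fix v :: "real^'n" assume v: "v \<noteq> 0"
  let ?f = "\<lambda>l. v \<bullet> (BBt_integrand A B l *v v)"
  have cont: "continuous_on {0..s} ?f"
    unfolding quadratic_form_entries using continuous_on_BBt_integrand[of "{0..s}" A B]
    by (intro continuous_intros continuous_on_component)
  have nonneg: "?f l \<ge> 0" for l
    unfolding BBt_integrand_form by (rule pos_def_nonneg[OF B])
  \<comment> \<open>At 0 the exponential is the identity, so the integrand is the form of
    \<open>B ** transpose B\<close>; strict positivity at this one point, with continuity, rules out
    a zero integral.\<close>
  have "?f 0 > 0" using B v by (simp add: BBt_integrand_form pos_def_def)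
  then have "integral {0..s} ?f \<noteq> 0"
    using integral_eq_0_iff[OF cont s nonneg] s by force
  moreover have "integral {0..s} ?f \<ge> 0"
    by (rule integral_nonneg[OF integrable_continuous_interval[OF cont]]) (rule nonneg)
  ultimately show "v \<bullet> (BBt_s A B s *v v) > 0"
    unfolding BBt_s_eq integral_quadratic_form[OF BBt_integrand_integrable] by linarith
qed

definition Q_integrand :: "real^'n^'n \<Rightarrow> real \<Rightarrow> real^'n^'n" where
  "Q_integrand A s = transpose (A_s A s) ** A_s A s"

lemma Qbar_eq: "Qbar A \<tau> = integral {0..\<tau>} (Q_integrand A)"
  unfolding Qbar_def Q_integrand_def[abs_def] A_s_def mexp_transpose ..

lemma continuous_on_Q_integrand: "continuous_on S (Q_integrand A)"
  unfolding Q_integrand_def[abs_def] by (intro continuous_intros)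

lemma Q_integrand_form: "v \<bullet> (Q_integrand A s *v v) = (norm (A_s A s *v v))\<^sup>2"
  by (simp only: Q_integrand_def matrix_vector_mul_assoc[symmetric] inner_matrix_transpose transpose_transpose
      power2_norm_eq_inner)

lemma qnorm2_Qbar_nonneg: "0 \<le> qnorm2 (Qbar A \<tau>) v"
proof -
  have "Q_integrand A integrable_on {0..\<tau>}"
    by (rule integrable_continuous_interval[OF continuous_on_Q_integrand])
  moreover have "continuous_on {0..\<tau>} (\<lambda>s. v \<bullet> (Q_integrand A s *v v))"
    unfolding quadratic_form_entries using continuous_on_Q_integrand[of "{0..\<tau>}" A]
    by (intro continuous_intros continuous_on_component)
  ultimately show ?thesis
    unfolding qnorm2_def Qbar_eq
    by (simp only: integral_quadratic_form)
       (intro integral_nonneg integrable_continuous_interval; simp add: Q_integrand_form)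
qed

text \<open>Here \<open>W\<close> stands for the error covariance at the start of the period.\<close>

lemma period_distortion_has_integral:
  fixes A B W :: "real^'n^'n"
  assumes \<tau>: "\<tau> > 0"
  shows "((\<lambda>s. (\<Sum>i\<in>UNIV. \<Sum>j\<in>UNIV. Q_integrand A s $ i $ j * W $ i $ j) + trace (BBt_s A B s))
    has_integral (\<Sum>i\<in>UNIV. \<Sum>j\<in>UNIV. Qbar A \<tau> $ i $ j * W $ i $ j) + bbar A B \<tau>) {0..\<tau>}"
proof -
  have Q: "Q_integrand A integrable_on {0..\<tau>}"
    by (rule integrable_continuous_interval[OF continuous_on_Q_integrand])
  have BB: "BBt_s A B integrable_on {0..\<tau>}"
    by (rule integrable_continuous_interval[OF continuous_on_BBt_s])
  have "((\<lambda>s. Q_integrand A s $ i $ j) has_integral Qbar A \<tau> $ i $ j) {0..\<tau>}" for i j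
    unfolding Qbar_eq integral_matrix_entry(1)[OF Q] by (rule integrable_integral[OF integral_matrix_entry(2)[OF Q]])
  moreover have "((\<lambda>s. trace (BBt_s A B s)) has_integral bbar A B \<tau>) {0..\<tau>}"
    unfolding bbar_def trace_def integral_matrix_entry(1)[OF BB]
    by (intro has_integral_sum integrable_integral integral_matrix_entry(2)[OF BB]) auto
  ultimately show ?thesis
    by (intro has_integral_add has_integral_sum has_integral_mult_left) auto
qed

section \<open>From continuous to discrete time\<close>

context prob_space
begin

lemma square_integrable_add:
  fixes f g :: "'a \<Rightarrow> real"
  assumes [measurable]: "f \<in> borel_measurable M" "g \<in> borel_measurable M"
    and "integrable M (\<lambda>w. (f w)\<^sup>2)" "integrable M (\<lambda>w. (g w)\<^sup>2)"
  shows "integrable M (\<lambda>w. (f w + g w)\<^sup>2)"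
proof (rule Bochner_Integration.integrable_bound)
  show "integrable M (\<lambda>w. 2 * (f w)\<^sup>2 + 2 * (g w)\<^sup>2)" using assms by simp
  have "(a + b)\<^sup>2 \<le> 2 * a\<^sup>2 + 2 * b\<^sup>2" for a b :: real
    using zero_le_power2[of "a - b"] by (simp add: power2_sum power2_diff)
  then show "AE w in M. norm ((f w + g w)\<^sup>2) \<le> norm (2 * (f w)\<^sup>2 + 2 * (g w)\<^sup>2)" by simp
qed simp

lemma square_integrable_sum:
  fixes f :: "'i \<Rightarrow> 'a \<Rightarrow> real"
  assumes "finite I" "\<And>i. i \<in> I \<Longrightarrow> f i \<in> borel_measurable M" "\<And>i. i \<in> I \<Longrightarrow> integrable M (\<lambda>w. (f i w)\<^sup>2)"
  shows "integrable M (\<lambda>w. (\<Sum>i\<in>I. f i w)\<^sup>2)"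
  using assms by (induction I) (auto intro!: square_integrable_add)

lemma square_integrable_mult:
  fixes f g :: "'a \<Rightarrow> real"
  assumes [measurable]: "f \<in> borel_measurable M" "g \<in> borel_measurable M"
    and "integrable M (\<lambda>w. (f w)\<^sup>2)" "integrable M (\<lambda>w. (g w)\<^sup>2)"
  shows "integrable M (\<lambda>w. f w * g w)"
proof (rule Bochner_Integration.integrable_bound)
  show "integrable M (\<lambda>w. (f w)\<^sup>2 + (g w)\<^sup>2)" using assms by simp
  have "\<bar>a * b\<bar> \<le> a\<^sup>2 + b\<^sup>2" for a b :: real
  proof -
    have "0 \<le> \<bar>a\<bar> * \<bar>b\<bar>" by simp
    with sum_squares_bound[of "\<bar>a\<bar>" "\<bar>b\<bar>"] show ?thesis
      unfolding abs_mult power2_abs by linarith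
  qed
  then show "AE w in M. norm (f w * g w) \<le> norm ((f w)\<^sup>2 + (g w)\<^sup>2)" by simp
qed simp

text \<open>The same duality as for conditional independence: the centred indicator of
  \<open>E\<close> has zero conditional expectation given \<open>F\<close>, so it is orthogonal to
  \<open>f\<close>.\<close>

lemma indep_set_integral_indicator:
  fixes f :: "'a \<Rightarrow> real"
  assumes ind: "indep_set (sets F) (sets G)" and F: "subalgebra M F"
    and f: "f \<in> borel_measurable F" "integrable M f" and E: "E \<in> sets G"
  shows "(\<integral>w. indicator E w * f w \<partial>M) = prob E * expectation f"
proof -
  interpret F: sigma_finite_subalgebra M F by (rule subalgebra_sigma_finite[OF F])
  have EM: "E \<in> events" using indep_setD_ev2[OF ind] E by auto
  let ?g = "\<lambda>w. indicator E w - prob E"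
  have g: "integrable M ?g" using integrable_indicator_real[OF EM] by simp
  have "AE w in M. real_cond_exp M F ?g w = 0"
  proof (rule real_cond_exp_eqI[OF F g])
    fix D assume D: "D \<in> sets F"
    then have DM: "D \<in> events" using F by (auto simp: subalgebra_def)
    have "(\<integral>w. indicator D w * (?g w - 0) \<partial>M) = (\<integral>w. indicator (D \<inter> E) w - indicator D w * prob E \<partial>M)"
      by (simp add: right_diff_distrib indicator_inter_arith)
    also have "\<dots> = prob (D \<inter> E) - prob D * prob E"
      using DM EM integrable_indicator_real[of D] integrable_indicator_real[of "D \<inter> E"] by simp
    also have "\<dots> = 0" using indep_setD[OF ind D E] by simp
    finally show "(\<integral>w. indicator D w * (?g w - 0) \<partial>M) = 0" .
  qed auto
  moreover have ifg: "integrable M (\<lambda>w. f w * ?g w)"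
    using f integrable_mult_indicator_real(2)[OF EM f(2)] by (simp add: right_diff_distrib)
  ultimately have "(\<integral>w. f w * ?g w \<partial>M) = 0"
    using f g EM by (subst F.real_cond_exp_intg(2)[symmetric]) (auto intro!: integral_eq_zero_AE)
  then show ?thesis
    using f integrable_mult_indicator_real(2)[OF EM f(2)]
    by (simp add: right_diff_distrib mult.commute)
qed

lemma indep_set_real_cond_exp:
  fixes f :: "'a \<Rightarrow> real"
  assumes ind: "indep_set (sets F) (sets G)" and F: "subalgebra M F"
    and f: "f \<in> borel_measurable F" "integrable M f" "expectation f = 0"
    and P: "subalgebra M P" "sets P \<subseteq> sets G"
  shows "AE w in M. real_cond_exp M P f w = 0"
  by (rule real_cond_exp_eqI[OF P(1)])
    (use f P indep_set_integral_indicator[OF ind F f(1,2)] in auto)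

text \<open>The cross terms vanish because \<open>n\<close> is uncorrelated with everything measurable with respect to \<open>Y\<close>,
  in particular with the error \<open>z\<close>.\<close>

lemma propagated_error:
  fixes x n :: "'a \<Rightarrow> real^'n" and C :: "real^'n^'n"
  assumes sub: "subalgebra M F" "subalgebra M Y" "subalgebra Y F"
    and x: "x \<in> borel_measurable Y" "\<And>i. integrable M (\<lambda>w. (x w $ i)\<^sup>2)"
    and n: "n \<in> borel_measurable M" "\<And>i. integrable M (\<lambda>w. (n w $ i)\<^sup>2)"
      "\<And>i. AE w in M. real_cond_exp M Y (\<lambda>w. n w $ i) w = 0"
  defines "z \<equiv> \<lambda>w. x w - vcond_exp M F x w"
  defines "X \<equiv> \<lambda>w. C *v x w + n w"
  defines "W \<equiv> \<chi> i j. expectation (\<lambda>w. z w $ i * z w $ j)"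
  defines "e \<equiv> (\<Sum>i\<in>UNIV. \<Sum>j\<in>UNIV. (transpose C ** C) $ i $ j * W $ i $ j) + (\<Sum>i\<in>UNIV. expectation (\<lambda>w. (n w $ i)\<^sup>2))"
  shows "(\<integral>\<^sup>+w. ennreal ((norm (X w - vcond_exp M F X w))\<^sup>2) \<partial>M) = ennreal e" "0 \<le> e"
    "(\<And>v. 0 \<le> qnorm2 Q v) \<Longrightarrow>
      (\<integral>\<^sup>+w. ennreal (qnorm2 Q (z w)) \<partial>M) = ennreal (\<Sum>i\<in>UNIV. \<Sum>j\<in>UNIV. Q $ i $ j * W $ i $ j)"
    "(\<And>v. 0 \<le> qnorm2 Q v) \<Longrightarrow> 0 \<le> (\<Sum>i\<in>UNIV. \<Sum>j\<in>UNIV. Q $ i $ j * W $ i $ j)"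
proof -
  interpret F: sigma_finite_subalgebra M F by (rule subalgebra_sigma_finite) fact
  interpret Y: sigma_finite_subalgebra M Y by (rule subalgebra_sigma_finite) fact
  have xM [measurable]: "x \<in> borel_measurable M" by (rule measurable_from_subalg[OF sub(2) x(1)])
  note n(1) [measurable]
  have xn: "vcond_exp M F x w $ i = real_cond_exp M F (\<lambda>w. x w $ i) w" for w i
    by (simp add: vcond_exp_def)
  have ix: "integrable M (\<lambda>w. x w $ i)" for i
    by (rule square_integrable_imp_integrable[OF borel_measurable_vec_nth[OF xM] x(2)])
  have in': "integrable M (\<lambda>w. n w $ i)" for i
    by (rule square_integrable_imp_integrable[OF borel_measurable_vec_nth[OF n(1)] n(2)])
  have zY: "(\<lambda>w. z w $ i) \<in> borel_measurable Y" for i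
  proof -
    have "real_cond_exp M F (\<lambda>w. x w $ i) \<in> borel_measurable Y"
      by (rule measurable_from_subalg[OF sub(3)]) simp
    then show ?thesis using x(1) by (simp add: z_def xn borel_measurable_vec_nth)
  qed
  have zM [measurable]: "(\<lambda>w. z w $ i) \<in> borel_measurable M" for i
    by (rule measurable_from_subalg[OF sub(2) zY])
  \<comment> \<open>The conditional mean is square integrable by Jensen's inequality.\<close>
  have z2: "integrable M (\<lambda>w. (z w $ i)\<^sup>2)" for i
  proof -
    have "integrable M (\<lambda>w. (real_cond_exp M F (\<lambda>w. x w $ i) w)\<^sup>2)"
      by (rule F.integrable_convex_cond_exp[where I=UNIV]) (use ix x(2) convex_power2 in auto)
    then have "integrable M (\<lambda>w. (x w $ i + (- real_cond_exp M F (\<lambda>w. x w $ i) w))\<^sup>2)"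
      using x(2) by (intro square_integrable_add) auto
    then show ?thesis by (simp add: z_def xn)
  qed
  have izz: "integrable M (\<lambda>w. z w $ i * z w $ j)" for i j
    by (intro square_integrable_mult z2) measurable
  have izn: "integrable M (\<lambda>w. z w $ i * n w $ j)" for i j
    by (intro square_integrable_mult z2 n) measurable
  have Ezn: "expectation (\<lambda>w. z w $ i * n w $ j) = 0" for i j
  proof -
    have "expectation (\<lambda>w. z w $ i * n w $ j) = expectation (\<lambda>w. z w $ i * real_cond_exp M Y (\<lambda>w. n w $ j) w)"
      by (rule Y.real_cond_exp_intg(2)[symmetric, OF izn zY]) measurable
    also have "\<dots> = 0" using n(3)[of j] by (auto intro!: integral_eq_zero_AE)
    finally show ?thesis .
  qed
  \<comment> \<open>Conditioning on \<open>F\<close> commutes with the matrix \<open>C\<close>, and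
    the noise has zero conditional mean given \<open>F\<close> because it has zero conditional mean
    given the larger \<open>Y\<close>.\<close>
  have "AE w in M. X w $ i - vcond_exp M F X w $ i = (C *v z w) $ i + n w $ i" for i
  proof -
    have Xi: "(\<lambda>w. X w $ i) = (\<lambda>w. (\<Sum>j\<in>UNIV. C $ i $ j * x w $ j) + n w $ i)"
      by (simp add: X_def matrix_vector_mult_def)
    have "AE w in M. real_cond_exp M F (\<lambda>w. X w $ i) w
        = real_cond_exp M F (\<lambda>w. \<Sum>j\<in>UNIV. C $ i $ j * x w $ j) w + real_cond_exp M F (\<lambda>w. n w $ i) w"
      unfolding Xi using ix in' by (intro F.real_cond_exp_add Bochner_Integration.integrable_sum) auto
    moreover have "AE w in M. real_cond_exp M F (\<lambda>w. \<Sum>j\<in>UNIV. C $ i $ j * x w $ j) w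
        = (\<Sum>j\<in>UNIV. real_cond_exp M F (\<lambda>w. C $ i $ j * x w $ j) w)"
      using ix by (intro F.real_cond_exp_sum) auto
    moreover have "AE w in M. \<forall>j. real_cond_exp M F (\<lambda>w. C $ i $ j * x w $ j) w = C $ i $ j * real_cond_exp M F (\<lambda>w. x w $ j) w"
      using ix unfolding AE_all_countable by (auto intro!: F.real_cond_exp_cmult)
    moreover have "AE w in M. real_cond_exp M F (\<lambda>w. n w $ i) w = 0"
    proof -
      have "AE w in M. real_cond_exp M F (real_cond_exp M Y (\<lambda>w. n w $ i)) w = real_cond_exp M F (\<lambda>w. n w $ i) w"
        by (rule F.real_cond_exp_nested_subalg[OF sub(2,3) in'])
      moreover have "AE w in M. real_cond_exp M F (real_cond_exp M Y (\<lambda>w. n w $ i)) w = real_cond_exp M F (\<lambda>_. 0) w"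
        using n(3) by (intro F.real_cond_exp_cong) auto
      moreover have "AE w in M. real_cond_exp M F (\<lambda>_. 0) w = 0"
        by (intro F.real_cond_exp_F_meas) auto
      ultimately show ?thesis by eventually_elim simp
    qed
    ultimately show ?thesis
    proof eventually_elim
      case (elim w)
      then show ?case
        by (simp add: vcond_exp_def fun_cong[OF Xi] matrix_vector_mult_def z_def right_diff_distrib sum_subtractf)
    qed
  qed
  then have "AE w in M. \<forall>i. X w $ i - vcond_exp M F X w $ i = (C *v z w) $ i + n w $ i"
    unfolding AE_all_countable by blast
  then have XC: "AE w in M. X w - vcond_exp M F X w = C *v z w + n w"
    by eventually_elim (simp add: vec_eq_iff)
  define q where "q w = (\<Sum>i\<in>UNIV. \<Sum>j\<in>UNIV. (transpose C ** C) $ i $ j * (z w $ i * z w $ j))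
    + 2 * (\<Sum>i\<in>UNIV. \<Sum>j\<in>UNIV. C $ i $ j * (z w $ j * n w $ i)) + (\<Sum>i\<in>UNIV. (n w $ i)\<^sup>2)" for w
  have nq: "(norm (C *v z w + n w))\<^sup>2 = q w" for w
  proof -
    have "(norm (C *v z w + n w))\<^sup>2 = (C *v z w) \<bullet> (C *v z w) + 2 * ((C *v z w) \<bullet> n w) + n w \<bullet> n w"
      by (simp add: power2_norm_eq_inner inner_add_left inner_add_right inner_commute)
    also have "(C *v z w) \<bullet> (C *v z w) = z w \<bullet> ((transpose C ** C) *v z w)"
      by (simp only: inner_matrix_transpose[of "z w"] matrix_vector_mul_assoc[symmetric] transpose_transpose)
    also have "(C *v z w) \<bullet> n w = (\<Sum>i\<in>UNIV. \<Sum>j\<in>UNIV. C $ i $ j * (z w $ j * n w $ i))"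
      by (simp add: inner_vec_def matrix_vector_mult_def sum_distrib_right mult.assoc)
    also have "n w \<bullet> n w = (\<Sum>i\<in>UNIV. (n w $ i)\<^sup>2)"
      by (simp add: inner_vec_def power2_eq_square)
    finally show ?thesis unfolding q_def quadratic_form_entries by simp
  qed
  have iq: "integrable M q"
    unfolding q_def using izz izn n(2)
    by (intro Bochner_Integration.integrable_add Bochner_Integration.integrable_sum integrable_mult_right) auto
  have q0: "0 \<le> q w" for w by (simp add: nq[symmetric])
  have Eq: "expectation q = e"
    unfolding q_def e_def W_def using izz izn n(2) by (simp add: Ezn)
  show "0 \<le> e" unfolding Eq[symmetric] by (rule integral_nonneg_AE) (simp add: q0)
  have "(\<integral>\<^sup>+w. ennreal ((norm (X w - vcond_exp M F X w))\<^sup>2) \<partial>M) = (\<integral>\<^sup>+w. ennreal (q w) \<partial>M)"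
  proof (rule nn_integral_cong_AE)
    from XC show "AE w in M. ennreal ((norm (X w - vcond_exp M F X w))\<^sup>2) = ennreal (q w)"
      by eventually_elim (simp add: nq)
  qed
  also have "\<dots> = ennreal e"
    using nn_integral_eq_integral[OF iq] q0 Eq by simp
  finally show "(\<integral>\<^sup>+w. ennreal ((norm (X w - vcond_exp M F X w))\<^sup>2) \<partial>M) = ennreal e" .
  assume Q: "\<And>v. 0 \<le> qnorm2 Q v"
  have iQ: "integrable M (\<lambda>w. qnorm2 Q (z w))"
    unfolding qnorm2_def quadratic_form_entries using izz by (intro Bochner_Integration.integrable_sum) auto
  have EQ: "expectation (\<lambda>w. qnorm2 Q (z w)) = (\<Sum>i\<in>UNIV. \<Sum>j\<in>UNIV. Q $ i $ j * W $ i $ j)"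
    unfolding qnorm2_def quadratic_form_entries W_def using izz by simp
  show "(\<integral>\<^sup>+w. ennreal (qnorm2 Q (z w)) \<partial>M) = ennreal (\<Sum>i\<in>UNIV. \<Sum>j\<in>UNIV. Q $ i $ j * W $ i $ j)"
    using nn_integral_eq_integral[OF iQ] Q EQ by simp
  show "0 \<le> (\<Sum>i\<in>UNIV. \<Sum>j\<in>UNIV. Q $ i $ j * W $ i $ j)"
    unfolding EQ[symmetric] using Q by (intro integral_nonneg_AE) simp
qed

end

section \<open>The error between sampling instants\<close>

lemma ct_source_increment:
  fixes A B S0 :: "real^'n^'n"
  assumes src: "ct_source M A B S0 x" and B: "pos_def (B ** transpose B)" and st: "0 \<le> s" "s < t"
  defines "n \<equiv> \<lambda>w. x t w - A_s A (t - s) *v x s w"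
  shows "n \<in> borel_measurable M" "integrable M (\<lambda>w. (n w $ i)\<^sup>2)" "integral\<^sup>L M (\<lambda>w. n w $ i) = 0"
    "integral\<^sup>L M (\<lambda>w. (n w $ i)\<^sup>2) = BBt_s A B (t - s) $ i $ i"
    "prob_space.indep_set M (sets (sig M (gen_sets M borel n))) (sets (sig M (\<Union>r\<in>{0..s}. gen_sets M borel (x r))))"
proof -
  interpret prob_space M using src by (simp add: ct_source_def)
  have x: "x t \<in> borel_measurable M" "x s \<in> borel_measurable M" using src st by (auto simp: ct_source_def)
  have lin: "(\<lambda>v. A_s A (t - s) *v v) \<in> borel_measurable borel"
    by (intro borel_measurable_continuous_onI linear_continuous_on matrix_vector_mul_bounded_linear)
  show nM: "n \<in> borel_measurable M"
    unfolding n_def using x measurable_compose[OF x(2) lin] by measurable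
  have d: "distr M borel n = gauss (BBt_s A B (t - s))"
    using src st unfolding ct_source_def n_def by blast
  have "pos_def (BBt_s A B (t - s))" using pos_def_BBt_s[OF B] st by simp
  from gauss_moments[OF this nM d]
  show "integrable M (\<lambda>w. (n w $ i)\<^sup>2)" "integral\<^sup>L M (\<lambda>w. n w $ i) = 0"
    "integral\<^sup>L M (\<lambda>w. (n w $ i)\<^sup>2) = BBt_s A B (t - s) $ i $ i" by auto
  show "indep_set (sets (sig M (gen_sets M borel n))) (sets (sig M (\<Union>r\<in>{0..s}. gen_sets M borel (x r))))"
    using src st unfolding ct_source_def n_def by blast
qed

lemma ct_source_square_integrable:
  fixes A B S0 :: "real^'n^'n"
  assumes src: "ct_source M A B S0 x" and B: "pos_def (B ** transpose B)" and S0: "pos_def S0" and t: "0 \<le> t"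
  shows "integrable M (\<lambda>w. (x t w $ i)\<^sup>2)"
proof -
  interpret prob_space M using src by (simp add: ct_source_def)
  have x: "x r \<in> borel_measurable M" if "0 \<le> r" for r using src that by (auto simp: ct_source_def)
  note [measurable] = x[OF order_refl] x[OF t]
  have x0: "integrable M (\<lambda>w. (x 0 w $ i)\<^sup>2)" for i
    using gauss_moments(1)[OF S0 x[OF order_refl]] src by (auto simp: ct_source_def)
  show ?thesis
  \<comment> \<open>\<open>ct_source\<close> describes increments over intervals of positive length
    only; at \<open>t = 0\<close> the initial law is used instead.\<close>
  proof (cases "t = 0")
    case False
    with t have t0: "0 < t" by simp
    let ?n = "\<lambda>w. x t w - A_s A (t - 0) *v x 0 w"
    note inc = ct_source_increment[OF src B order_refl t0]
    note [measurable] = borel_measurable_vec_nth[OF inc(1)]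
    have "integrable M (\<lambda>w. ((\<Sum>j\<in>UNIV. A_s A (t - 0) $ i $ j * x 0 w $ j) + ?n w $ i)\<^sup>2)"
      by (rule square_integrable_add[OF _ borel_measurable_vec_nth[OF inc(1)] _ inc(2)])
        (use x0 in \<open>auto intro!: square_integrable_sum simp: power_mult_distrib\<close>)
    then show ?thesis by (simp add: matrix_vector_mult_def)
  qed (use x0 in simp)
qed

text \<open>Between the sampling instants \<open>k\<tau>\<close> and \<open>(k+1)\<tau>\<close> no codeword arrives, so the error evolves freely.\<close>

lemma ct_intersample_error:
  fixes A B S0 :: "real^'n^'n" and x :: "real \<Rightarrow> real \<Rightarrow> real^'n" and a :: "nat \<Rightarrow> real \<Rightarrow> bool list"
  assumes src: "ct_source M A B S0 x" and B: "pos_def (B ** transpose B)" and S0: "pos_def S0" and \<tau>: "\<tau> > 0"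
    and ck: "causal_kernel M cw (\<Union>t\<in>{0..}. gen_sets M borel (x t)) (\<lambda>k. \<Union>j\<le>k. gen_sets M borel (x (real j * \<tau>))) a"
  defines "F \<equiv> \<lambda>k. sig M (\<Union>j\<le>k. gen_sets M cw (a j))"
  defines "z \<equiv> \<lambda>k w. x (real k * \<tau>) w - vcond_exp M (F k) (x (real k * \<tau>)) w"
  defines "W \<equiv> \<lambda>k. \<chi> i j. integral\<^sup>L M (\<lambda>w. z k w $ i * z k w $ j)"
  defines "e \<equiv> \<lambda>k s. (\<Sum>i\<in>UNIV. \<Sum>j\<in>UNIV. Q_integrand A s $ i $ j * W k $ i $ j) + trace (BBt_s A B s)"
  shows "s > 0 \<Longrightarrow> (\<integral>\<^sup>+w. ennreal ((norm (x (real k * \<tau> + s) w - vcond_exp M (F k) (x (real k * \<tau> + s)) w))\<^sup>2) \<partial>M) = ennreal (e k s)"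
    and "s > 0 \<Longrightarrow> 0 \<le> e k s"
    and "(\<integral>\<^sup>+w. ennreal (qnorm2 (Qbar A \<tau>) (z k w)) \<partial>M) = ennreal (\<Sum>i\<in>UNIV. \<Sum>j\<in>UNIV. Qbar A \<tau> $ i $ j * W k $ i $ j)"
    and "0 \<le> (\<Sum>i\<in>UNIV. \<Sum>j\<in>UNIV. Qbar A \<tau> $ i $ j * W k $ i $ j)"
proof -
  interpret prob_space M using src by (simp add: ct_source_def)
  let ?Src = "\<Union>t\<in>{0..}. gen_sets M borel (x t)"
  let ?past = "\<lambda>k. \<Union>j\<le>k. gen_sets M borel (x (real j * \<tau>))"
  let ?Y = "sig M (?past k \<union> (\<Union>j\<le>k. gen_sets M cw (a j)))"
  have xM: "x t \<in> borel_measurable M" if "0 \<le> t" for t using src that by (auto simp: ct_source_def)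
  have gx: "gen_sets M borel (x t) \<subseteq> sets M" if "0 \<le> t" for t by (rule gen_sets_subset[OF xM[OF that]])
  have ga: "gen_sets M cw (a j) \<subseteq> sets M" for j using ck by (intro gen_sets_subset) (simp add: causal_kernel_def)
  have kt: "0 \<le> real j * \<tau>" for j using \<tau> by simp
  have SM: "?Src \<subseteq> sets M" using gx by auto
  have pS: "?past k \<subseteq> ?Src" for k using kt by fastforce
  have pM: "?past k \<subseteq> sets M" for k using pS SM by blast
  have pmono: "mono ?past" by (intro monoI UN_mono) auto
  have aM: "(\<Union>j\<le>k. gen_sets M cw (a j)) \<subseteq> sets M" using ga by blast
  have YM: "?past k \<union> (\<Union>j\<le>k. gen_sets M cw (a j)) \<subseteq> sets M" using pM aM by blast
  have sub: "subalgebra M (F k)" "subalgebra M ?Y" "subalgebra ?Y (F k)"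
    unfolding F_def by (rule subalgebra_sig[OF aM] subalgebra_sig[OF YM] subalgebra_sig_mono[OF Un_upper2 YM])+
  have xY: "x (real k * \<tau>) \<in> borel_measurable ?Y"
    by (rule measurable_gen_sets[OF xM[OF kt]]) (use sig_superset[OF YM] in auto)
  have ci: "cond_indep (sig M (?past k)) (sig M ?Src) ?Y"
    by (rule causal_kernel_cond_indep[OF pM pS pmono SM ck])
  have x2: "integrable M (\<lambda>w. (x (real k * \<tau>) w $ i)\<^sup>2)" for i
    by (rule ct_source_square_integrable[OF src B S0 kt])
  have main: "(\<integral>\<^sup>+w. ennreal ((norm (x (real k * \<tau> + s) w - vcond_exp M (F k) (x (real k * \<tau> + s)) w))\<^sup>2) \<partial>M) = ennreal (e k s)
      \<and> 0 \<le> e k s \<and> (\<integral>\<^sup>+w. ennreal (qnorm2 (Qbar A \<tau>) (z k w)) \<partial>M) = ennreal (\<Sum>i\<in>UNIV. \<Sum>j\<in>UNIV. Qbar A \<tau> $ i $ j * W k $ i $ j)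
      \<and> 0 \<le> (\<Sum>i\<in>UNIV. \<Sum>j\<in>UNIV. Qbar A \<tau> $ i $ j * W k $ i $ j)" if s: "s > 0" for s
  proof -
    let ?t = "real k * \<tau> + s"
    define n where "n w = x ?t w - A_s A s *v x (real k * \<tau>) w" for w
    have kt_less: "real k * \<tau> < ?t" using s by simp
    note inc = ct_source_increment[OF src B kt kt_less, unfolded add_diff_cancel_left', folded n_def]
    let ?N = "sig M (gen_sets M borel n)"
    have NM: "gen_sets M borel n \<subseteq> sets M" by (rule gen_sets_subset[OF inc(1)])
    have n_int: "integrable M (\<lambda>w. n w $ i)" for i
      by (rule square_integrable_imp_integrable[OF borel_measurable_vec_nth[OF inc(1)] inc(2)])
    have nS: "(\<lambda>w. n w $ i) \<in> borel_measurable (sig M ?Src)" for i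
    proof -
      have xS: "x r \<in> borel_measurable (sig M ?Src)" if "0 \<le> r" for r
        by (rule measurable_gen_sets[OF xM[OF that]]) (use sig_superset[OF SM] that in auto)
      have "(\<lambda>v. A_s A s *v v) \<in> borel_measurable borel"
        by (intro borel_measurable_continuous_onI linear_continuous_on matrix_vector_mul_bounded_linear)
      from measurable_compose[OF xS[OF kt] this] have "n \<in> borel_measurable (sig M ?Src)"
        unfolding n_def using xS[of ?t] kt[of k] s by (intro borel_measurable_diff) auto
      then show ?thesis by (rule borel_measurable_vec_nth)
    qed
    \<comment> \<open>Conditional independence removes the codewords from the condition; the
      remaining samples lie in the past of \<open>k\<tau>\<close>, of which the centred noise is
      independent.\<close>
    have n0: "AE w in M. real_cond_exp M ?Y (\<lambda>w. n w $ i) w = 0" for i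
    proof -
      have "AE w in M. real_cond_exp M ?Y (\<lambda>w. n w $ i) w = real_cond_exp M (sig M (?past k)) (\<lambda>w. n w $ i) w"
        by (rule cond_indep_real_cond_exp[OF subalgebra_sig[OF pM] subalgebra_sig[OF SM] sub(2)
              subalgebra_sig_mono[OF Un_upper1 YM] ci n_int nS])
      moreover have "AE w in M. real_cond_exp M (sig M (?past k)) (\<lambda>w. n w $ i) w = 0"
      proof (rule indep_set_real_cond_exp[OF inc(5) subalgebra_sig[OF NM] _ n_int inc(3) subalgebra_sig[OF pM]])
        show "(\<lambda>w. n w $ i) \<in> borel_measurable ?N"
          by (intro borel_measurable_vec_nth measurable_gen_sets[OF inc(1) sig_superset[OF NM]]) simp
        show "sets (sig M (?past k)) \<subseteq> sets (sig M (\<Union>r\<in>{0..real k * \<tau>}. gen_sets M borel (x r)))"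
        proof (rule sets_sig_mono)
          show "?past k \<subseteq> (\<Union>r\<in>{0..real k * \<tau>}. gen_sets M borel (x r))"
          proof (rule UN_least)
            fix j assume "j \<in> {..k}"
            then have "real j * \<tau> \<in> {0..real k * \<tau>}" using \<tau> by (auto intro: mult_right_mono)
            then show "gen_sets M borel (x (real j * \<tau>)) \<subseteq> (\<Union>r\<in>{0..real k * \<tau>}. gen_sets M borel (x r))" by blast
          qed
          show "(\<Union>r\<in>{0..real k * \<tau>}. gen_sets M borel (x r)) \<subseteq> sets M"
            by (rule UN_least) (simp add: gx)
        qed
      qed
      ultimately show ?thesis by eventually_elim simp
    qed
    have Xeq: "A_s A s *v x (real k * \<tau>) w + n w = x ?t w" for w by (simp add: n_def)
    have "(\<Sum>i\<in>UNIV. expectation (\<lambda>w. (n w $ i)\<^sup>2)) = trace (BBt_s A B s)"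
      by (simp add: inc(4) trace_def)
    then have ee: "e k s = (\<Sum>i\<in>UNIV. \<Sum>j\<in>UNIV. (transpose (A_s A s) ** A_s A s) $ i $ j * W k $ i $ j)
        + (\<Sum>i\<in>UNIV. expectation (\<lambda>w. (n w $ i)\<^sup>2))"
      by (simp add: e_def Q_integrand_def)
    note pe = propagated_error[OF sub xY x2 inc(1) inc(2) n0]
    show ?thesis
      unfolding ee W_def z_def
      using pe(1,2)[of "A_s A s", unfolded Xeq] pe(3,4)[of "Qbar A \<tau>", OF qnorm2_Qbar_nonneg] by blast
  qed
  show "s > 0 \<Longrightarrow> (\<integral>\<^sup>+w. ennreal ((norm (x (real k * \<tau> + s) w - vcond_exp M (F k) (x (real k * \<tau> + s)) w))\<^sup>2) \<partial>M) = ennreal (e k s)"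
    "s > 0 \<Longrightarrow> 0 \<le> e k s"
    "(\<integral>\<^sup>+w. ennreal (qnorm2 (Qbar A \<tau>) (z k w)) \<partial>M) = ennreal (\<Sum>i\<in>UNIV. \<Sum>j\<in>UNIV. Qbar A \<tau> $ i $ j * W k $ i $ j)"
    "0 \<le> (\<Sum>i\<in>UNIV. \<Sum>j\<in>UNIV. Qbar A \<tau> $ i $ j * W k $ i $ j)"
    \<comment> \<open>The last two claims do not involve \<open>s\<close>; any positive value, here
      1, yields them.\<close>
    using main main[of 1] by auto
qed

text \<open>Only a lower bound is wanted, so \<open>g\<close> enters through pointwise comparison
  under the nonnegative integral, and measurability is established for the continuous pieces
  alone.\<close>

lemma sum_periods_le_nn_integral:
  fixes f :: "nat \<Rightarrow> real \<Rightarrow> real" and g :: "real \<Rightarrow> ennreal"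
  assumes \<tau>: "\<tau> > 0"
    and f: "\<And>k. (f k has_integral c k) {0..\<tau>}" "\<And>k. continuous_on {0..\<tau>} (f k)" "\<And>k s. 0 < s \<Longrightarrow> 0 \<le> f k s"
    and le: "\<And>k s. 0 < s \<Longrightarrow> s < \<tau> \<Longrightarrow> ennreal (f k s) \<le> g (real k * \<tau> + s)"
  shows "(\<Sum>k<K. ennreal (c k)) \<le> (\<integral>\<^sup>+t\<in>{0..real K * \<tau>}. g t \<partial>lborel)"
proof -
  \<comment> \<open>Open periods are pairwise disjoint and leave out \<open>s = 0\<close>, where no
    comparison is available; the endpoints have measure zero.\<close>
  define I where "I k = {real k * \<tau><..<real k * \<tau> + \<tau>}" for k
  define h where "h k t = f k (t - real k * \<tau>)" for k t
  have h0: "0 \<le> h k t" if "t \<in> I k" for k t using that f(3) by (simp add: h_def I_def)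
  have hint: "(h k has_integral c k) (I k)" for k
  proof -
    have "((\<lambda>t. f k (1 *\<^sub>R t + (- (real k * \<tau>)))) has_integral (c k /\<^sub>R 1 ^ DIM(real)))
        (cbox ((0 - (- (real k * \<tau>))) /\<^sub>R 1) ((\<tau> - (- (real k * \<tau>))) /\<^sub>R 1))"
      using f(1)[of k] by (intro has_integral_affinity') auto
    then have "(h k has_integral c k) {real k * \<tau>..real k * \<tau> + \<tau>}"
      by (simp add: h_def[abs_def] add.commute)
    then show ?thesis unfolding I_def by (simp add: has_integral_Icc_iff_Ioo)
  qed
  have meas: "(\<lambda>t. ennreal (h k t) * indicator (I k) t) \<in> borel_measurable lborel" for k
  proof -
    have "continuous_on (I k) (h k)"
      unfolding h_def[abs_def] I_def
      by (rule continuous_on_compose2[OF f(2)[of k]]) (auto intro!: continuous_intros)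
    then have "(\<lambda>t. indicator (I k) t *\<^sub>R h k t) \<in> borel_measurable borel"
      by (intro borel_measurable_continuous_on_indicator) (auto simp: I_def)
    then have "(\<lambda>t. ennreal (indicator (I k) t *\<^sub>R h k t)) \<in> borel_measurable lborel" by simp
    also have "(\<lambda>t. ennreal (indicator (I k) t *\<^sub>R h k t)) = (\<lambda>t. ennreal (h k t) * indicator (I k) t)"
      by (auto simp: indicator_def)
    finally show ?thesis .
  qed
  have disj: "k = j" if "t \<in> I k" "t \<in> I j" for k j t
  proof -
    have *: "\<not> m < l" if "t \<in> I m" "t \<in> I l" for m l
    proof
      assume "m < l"
      then have "real m + 1 \<le> real l" by simp
      then have "(real m + 1) * \<tau> \<le> real l * \<tau>" using \<tau> by (intro mult_right_mono) auto
      then show False using that by (simp add: I_def distrib_right)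
    qed
    show ?thesis using *[OF that] *[OF that(2,1)] by simp
  qed
  have "(\<Sum>k<K. ennreal (c k)) = (\<Sum>k<K. \<integral>\<^sup>+t. ennreal (h k t) * indicator (I k) t \<partial>lborel)"
    by (intro sum.cong refl nn_integral_has_integral_lebesgue'[symmetric] h0 hint)
  also have "\<dots> = (\<integral>\<^sup>+t. (\<Sum>k<K. ennreal (h k t) * indicator (I k) t) \<partial>lborel)"
    by (rule nn_integral_sum[symmetric]) (rule meas)
  also have "\<dots> \<le> (\<integral>\<^sup>+t\<in>{0..real K * \<tau>}. g t \<partial>lborel)"
  proof (rule nn_integral_mono)
    fix t
    show "(\<Sum>k<K. ennreal (h k t) * indicator (I k) t) \<le> g t * indicator {0..real K * \<tau>} t"
    proof (cases "\<exists>k<K. t \<in> I k")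
      case True
      then obtain k where k: "k < K" "t \<in> I k" by blast
      have "(\<Sum>j<K. ennreal (h j t) * indicator (I j) t) = (\<Sum>j\<in>{k}. ennreal (h j t) * indicator (I j) t)"
        using k disj by (intro sum.mono_neutral_right) (auto simp: indicator_def)
      also have "\<dots> = ennreal (h k t)" using k by simp
      also have "\<dots> \<le> g t"
        using le[of "t - real k * \<tau>" k] k by (simp add: h_def I_def)
      also have "t \<in> {0..real K * \<tau>}"
      proof -
        have "(real k + 1) * \<tau> \<le> real K * \<tau>" using k \<tau> by (intro mult_right_mono) auto
        then have "real k * \<tau> + \<tau> \<le> real K * \<tau>" by (simp add: distrib_right)
        moreover have "real k * \<tau> < t" "t < real k * \<tau> + \<tau>" using k by (auto simp: I_def)
        moreover have "0 \<le> real k * \<tau>" using \<tau> by simp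
        ultimately show ?thesis unfolding atLeastAtMost_iff by linarith
      qed
      then have "g t = g t * indicator {0..real K * \<tau>} t" by simp
      finally show ?thesis .
    next
      case False
      then have "(\<Sum>k<K. ennreal (h k t) * indicator (I k) t) = 0" by (intro sum.neutral) (auto simp: indicator_def)
      then show ?thesis by simp
    qed
  qed
  finally show ?thesis .
qed

text \<open>Specialises the limit over real horizons \<open>T\<close> to
  \<open>T = K * \<tau>\<close>. Subtraction in \<open>ennreal\<close> truncates, so the offset
  \<open>b\<close> per period is removed in the reals, and a slack \<open>y'\<close> above the
  target makes the bound hold eventually.\<close>

lemma limsup_mean_le:
  fixes q :: "nat \<Rightarrow> real" and G :: "real \<Rightarrow> ennreal"
  assumes \<tau>: "\<tau> > 0" and q: "\<And>k. 0 \<le> q k" "\<And>k. 0 \<le> q k + b" and D: "0 < Dc * \<tau> - b" "0 < Dc"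
    and le: "\<And>K. (\<Sum>k<K. ennreal (q k + b)) \<le> G (real K * \<tau>)"
    and lim: "Limsup at_top (\<lambda>T. ennreal (1 / T) * G T) \<le> ennreal Dc"
  shows "limsup (\<lambda>K. ennreal (1 / real K) * (\<Sum>k<K. ennreal (q k))) \<le> ennreal (Dc * \<tau> - b)"
proof (rule dense_ge)
  fix y assume y: "ennreal (Dc * \<tau> - b) < y"
  show "limsup (\<lambda>K. ennreal (1 / real K) * (\<Sum>k<K. ennreal (q k))) \<le> y"
  proof (cases y)
    case (real y')
    then have y': "Dc * \<tau> - b < y'" using y D by (simp add: ennreal_less_iff)
    \<comment> \<open>\<open>(y' + b) / \<tau>\<close> is the distortion per unit time that
      corresponds to \<open>y'\<close> per sample.\<close>
    then have "Dc < (y' + b) / \<tau>" using \<tau> by (simp add: field_simps)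
    then have "Limsup at_top (\<lambda>T. ennreal (1 / T) * G T) < ennreal ((y' + b) / \<tau>)"
      using lim D by (auto intro: le_less_trans simp: ennreal_less_iff)
    then have "eventually (\<lambda>T. ennreal (1 / T) * G T < ennreal ((y' + b) / \<tau>)) at_top"
      by (rule Limsup_lessD)
    moreover have "filterlim (\<lambda>K. real K * \<tau>) at_top sequentially"
      using \<tau> by (intro filterlim_at_top_mult_tendsto_pos[OF tendsto_const _ filterlim_real_sequentially])
    ultimately have "eventually (\<lambda>K. ennreal (1 / (real K * \<tau>)) * G (real K * \<tau>) < ennreal ((y' + b) / \<tau>)) sequentially"
      by (rule eventually_compose_filterlim)
    then have "eventually (\<lambda>K. ennreal (1 / real K) * (\<Sum>k<K. ennreal (q k)) \<le> ennreal y') sequentially"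
      using eventually_gt_at_top[of 0]
    proof eventually_elim
      case (elim K)
      have "ennreal (1 / (real K * \<tau>) * (\<Sum>k<K. q k + b)) = ennreal (1 / (real K * \<tau>)) * (\<Sum>k<K. ennreal (q k + b))"
        using q \<tau> by (subst ennreal_mult') (auto simp: sum_ennreal)
      also have "\<dots> \<le> ennreal (1 / (real K * \<tau>)) * G (real K * \<tau>)"
        by (intro mult_left_mono le) auto
      also note elim(1)
      finally have "1 / (real K * \<tau>) * (\<Sum>k<K. q k + b) < (y' + b) / \<tau>"
        using \<tau> sum_nonneg[of "{..<K}" "\<lambda>k. q k + b", OF q(2)]
        by (subst (asm) ennreal_less_iff) (auto intro!: mult_nonneg_nonneg)
      then have "(\<Sum>k<K. q k) + real K * b < (y' + b) * real K"
        using \<tau> elim(2) by (simp add: sum.distrib field_simps)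
      then have "(\<Sum>k<K. q k) / real K \<le> y'"
        using elim(2) by (simp add: field_simps)
      moreover have "ennreal (1 / real K) * (\<Sum>k<K. ennreal (q k)) = ennreal ((\<Sum>k<K. q k) / real K)"
        using q by (simp add: sum_ennreal ennreal_mult[symmetric] sum_nonneg)
      ultimately show ?case by (simp add: ennreal_leI)
    qed
    then show ?thesis unfolding real by (rule Limsup_bounded)
  qed simp
qed

section \<open>The sampled process as a discrete-time realisation\<close>

lemma dt_source_sampled:
  assumes src: "ct_source M A B S0 x" and \<tau>: "\<tau> > 0"
  shows "dt_source M A B S0 \<tau> (\<lambda>k. x (real k * \<tau>))"
proof -
  interpret prob_space M using src by (simp add: ct_source_def)
  have x: "x t \<in> borel_measurable M" if "0 \<le> t" for t using src that by (auto simp: ct_source_def)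
  have "distr M borel (\<lambda>w. x (real (Suc k) * \<tau>) w - A_s A \<tau> *v x (real k * \<tau>) w) = gauss (BBt_s A B \<tau>)
    \<and> indep_set (sets (sig M (gen_sets M borel (\<lambda>w. x (real (Suc k) * \<tau>) w - A_s A \<tau> *v x (real k * \<tau>) w))))
        (sets (sig M (\<Union>j\<le>k. gen_sets M borel (x (real j * \<tau>)))))" for k
  proof -
    have st: "0 \<le> real k * \<tau>" "real k * \<tau> < real (Suc k) * \<tau>" using \<tau> by auto
    have diff: "real (Suc k) * \<tau> - real k * \<tau> = \<tau>" by (simp add: algebra_simps)
    \<comment> \<open>The step length is abstracted to \<open>d\<close>, so that \<open>diff\<close>
      replaces it consistently inside \<open>A_s\<close> and \<open>BBt_s\<close> and leaves the
      time arguments of \<open>x\<close> alone.\<close>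
    have "distr M borel (\<lambda>w. x (real (Suc k) * \<tau>) w - A_s A d *v x (real k * \<tau>) w) = gauss (BBt_s A B d)
      \<and> indep_set (sets (sig M (gen_sets M borel (\<lambda>w. x (real (Suc k) * \<tau>) w - A_s A d *v x (real k * \<tau>) w))))
          (sets (sig M (\<Union>r\<in>{0..real k * \<tau>}. gen_sets M borel (x r))))"
      if d: "d = real (Suc k) * \<tau> - real k * \<tau>" for d
      using src st unfolding ct_source_def d by blast
    note ct = this[OF diff[symmetric]]
    have "sets (sig M (\<Union>j\<le>k. gen_sets M borel (x (real j * \<tau>)))) \<subseteq> sets (sig M (\<Union>r\<in>{0..real k * \<tau>}. gen_sets M borel (x r)))"
    proof (rule sets_sig_mono)
      show "(\<Union>r\<in>{0..real k * \<tau>}. gen_sets M borel (x r)) \<subseteq> sets M"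
        by (rule UN_least) (simp add: gen_sets_subset x)
      show "(\<Union>j\<le>k. gen_sets M borel (x (real j * \<tau>))) \<subseteq> (\<Union>r\<in>{0..real k * \<tau>}. gen_sets M borel (x r))"
      proof (rule UN_least)
        fix j assume "j \<in> {..k}"
        then have "real j * \<tau> \<in> {0..real k * \<tau>}" using \<tau> by (auto intro: mult_right_mono)
        then show "gen_sets M borel (x (real j * \<tau>)) \<subseteq> (\<Union>r\<in>{0..real k * \<tau>}. gen_sets M borel (x r))" by blast
      qed
    qed
    with ct show ?thesis unfolding indep_sets2_eq by blast
  qed
  then show ?thesis
    using src x \<tau> prob_space_axioms unfolding dt_source_def by (auto simp: ct_source_def)
qed

lemma L_CT_ge_L_DT:
  fixes A B S0 :: "real^'n^'n"
  assumes B: "pos_def (B ** transpose B)" and S0: "pos_def S0" and Dc: "Dc > 0" and \<tau>: "\<tau> > 0" and Dd: "Dd A B Dc \<tau> > 0"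
  shows "L_CT A B S0 Dc \<tau> \<ge> L_DT A B S0 (Dd A B Dc \<tau>) (Qbar A \<tau>) \<tau>"
  unfolding L_CT_def
proof (rule INF_greatest, clarify)
  fix M :: "real measure" and x :: "real \<Rightarrow> real \<Rightarrow> real^'n" and a :: "nat \<Rightarrow> real \<Rightarrow> bool list"
  let ?Src = "\<Union>t\<in>{0..}. gen_sets M borel (x t)"
  let ?past = "\<lambda>k. \<Union>j\<le>k. gen_sets M borel (x (real j * \<tau>))"
  let ?F = "\<lambda>k. sig M (\<Union>j\<le>k. gen_sets M cw (a j))"
  let ?g = "\<lambda>t. \<integral>\<^sup>+ w. ennreal ((norm (x t w - vcond_exp M (?F (nat \<lfloor>t / \<tau>\<rfloor>)) (x t) w))\<^sup>2) \<partial>M"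
  assume src: "ct_source M A B S0 x" and ck: "causal_kernel M cw ?Src ?past a"
    and dist: "Limsup at_top (\<lambda>T. ennreal (1 / T) * (\<integral>\<^sup>+t\<in>{0..T}. ?g t \<partial>lborel)) \<le> ennreal Dc"
  interpret prob_space M using src by (simp add: ct_source_def)
  let ?z = "\<lambda>k w. x (real k * \<tau>) w - vcond_exp M (?F k) (x (real k * \<tau>)) w"
  define W where "W k = (\<chi> i j. expectation (\<lambda>w. ?z k w $ i * ?z k w $ j))" for k
  define e where "e k s = (\<Sum>i\<in>UNIV. \<Sum>j\<in>UNIV. Q_integrand A s $ i $ j * W k $ i $ j) + trace (BBt_s A B s)" for k s
  define q where "q k = (\<Sum>i\<in>UNIV. \<Sum>j\<in>UNIV. Qbar A \<tau> $ i $ j * W k $ i $ j)" for k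
  note ie = ct_intersample_error[OF src B S0 \<tau> ck, folded W_def, folded e_def q_def]
  have e_int: "(e k has_integral q k + bbar A B \<tau>) {0..\<tau>}" for k
    unfolding e_def[abs_def] q_def by (rule period_distortion_has_integral[OF \<tau>])
  have e_cont: "continuous_on {0..\<tau>} (e k)" for k
    unfolding e_def[abs_def] trace_def using continuous_on_Q_integrand[of "{0..\<tau>}" A] continuous_on_BBt_s[of \<tau> A B]
    by (intro continuous_intros continuous_on_component)
  \<comment> \<open>The sampled distortion plus offset is the integral of a mean squared error; the
    open interval is used because \<open>0 \<le> e k s\<close> is known for \<open>s > 0\<close>
    only.\<close>
  have qb: "0 \<le> q k + bbar A B \<tau>" for k
    using has_integral_nonneg[of "e k" "q k + bbar A B \<tau>" "{0<..<\<tau>}"] e_int[of k] ie(2)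
    by (auto simp: has_integral_Icc_iff_Ioo)
  have "(\<Sum>k<K. ennreal (q k + bbar A B \<tau>)) \<le> (\<integral>\<^sup>+t\<in>{0..real K * \<tau>}. ?g t \<partial>lborel)" for K
  proof (rule sum_periods_le_nn_integral[OF \<tau> e_int e_cont ie(2)])
    fix k s assume s: "0 < (s::real)" "s < \<tau>"
    \<comment> \<open>Strictly inside period \<open>k\<close> exactly the codewords
      \<open>a 0\<close> to \<open>a k\<close> are available, so \<open>?g\<close> is the error
      described by \<open>ie(1)\<close>.\<close>
    have "\<lfloor>(real k * \<tau> + s) / \<tau>\<rfloor> = int k"
      using s \<tau> by (intro floor_unique) (auto simp: field_simps)
    then have "nat \<lfloor>(real k * \<tau> + s) / \<tau>\<rfloor> = k" by simp
    then show "ennreal (e k s) \<le> ?g (real k * \<tau> + s)" using ie(1)[OF s(1), of k] by simp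
  qed
  then have "limsup (\<lambda>K. ennreal (1 / real K) * (\<Sum>k<K. ennreal (q k))) \<le> ennreal (Dc * \<tau> - bbar A B \<tau>)"
    using ie(4) qb Dd Dc dist
    by (intro limsup_mean_le[OF \<tau>, where G="\<lambda>T. \<integral>\<^sup>+t\<in>{0..T}. ?g t \<partial>lborel"]) (auto simp: Dd_def)
  then have dist': "limsup (\<lambda>K. ennreal (1 / real K) * (\<Sum>k<K. \<integral>\<^sup>+ w. ennreal (qnorm2 (Qbar A \<tau>) (?z k w)) \<partial>M)) \<le> ennreal (Dd A B Dc \<tau>)"
    by (simp add: ie(3) Dd_def)
  have SM: "?Src \<subseteq> sets M"
    using src by (intro UN_least gen_sets_subset) (simp add: ct_source_def)
  \<comment> \<open>In continuous time the kernel condition conditions on the whole path, in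
    discrete time on the samples only.\<close>
  have ck': "causal_kernel M cw (\<Union>j. gen_sets M borel (x (real j * \<tau>))) ?past a"
  proof (rule causal_kernel_restrict_source[OF _ _ SM ck])
    show "?past k \<subseteq> (\<Union>j. gen_sets M borel (x (real j * \<tau>)))" for k by blast
    have "0 \<le> real j * \<tau>" for j using \<tau> by simp
    then show "(\<Union>j. gen_sets M borel (x (real j * \<tau>))) \<subseteq> ?Src" by fastforce
  qed
  show "L_DT A B S0 (Dd A B Dc \<tau>) (Qbar A \<tau>) \<tau> \<le> enn2ereal (ct_rate M \<tau> a)"
    unfolding L_DT_def
    by (rule INF_lower2[where i="(M, \<lambda>k. x (real k * \<tau>), a)"])
      (use dt_source_sampled[OF src \<tau>] ck' dist' in auto)
qed

theorem theorem2:
  fixes A B S0 :: "real^'n^'n" and Dc \<tau> :: real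
  assumes "hurwitz A" and "pos_def (B ** transpose B)" and "pos_def S0"
    and "Dc > 0" and "\<tau> > 0" and "Dd A B Dc \<tau> > 0"
  shows "L_CT A B S0 Dc \<tau> \<ge> L_DT A B S0 (Dd A B Dc \<tau>) (Qbar A \<tau>) \<tau>
    \<and> L_DT A B S0 (Dd A B Dc \<tau>) (Qbar A \<tau>) \<tau>
        \<ge> ereal (1 / \<tau>) * theta_inv_e (R_DT A B S0 (Dd A B Dc \<tau>) (Qbar A \<tau>) \<tau>)"
  using L_CT_ge_L_DT[OF assms(2-6)] L_DT_ge_theta_inv[OF assms(5)] by blast

end
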